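(* Let $V^*$ be the dual of the vector module of $gl(m|n)$ and $V(\Lambda)$ a finite-dimensional irreducible $gl(m|n)$-module with highest weight $\Lambda$. Assume the numbers $\chi_{\Lambda-\varepsilon_r}(I_2)$, $1\le r\le m+n$, are pairwise distinct (equivalently, the roots $\alpha_r$ are pairwise distinct). Then $V^*\otimes V(\Lambda)$ is completely reducible, with maximal weight vectors of weights of the form $\Lambda-\varepsilon_r$ ($1\le r\le m+n$), each weight occurring at most once.
   Context: $gl(m|n)$ over $\mathbb{C}$ has basis $E_{pq}$ ($1\le p,q\le m+n$) of parity $(p)+(q)$, $(p)=0$ for $p\le m$ and $1$ otherwise, with graded bracket $[E_{pq},E_{rs}]=\delta_{qr}E_{ps}-(-1)^{((p)+(q))((r)+(s))}\delta_{ps}E_{rq}$. The vector module $V$ has basis $|s\rangle$ with $E_{pq}|s\rangle=\delta_{qs}|p\rangle$, and $V^*$ is its dual module. Weights are written $\Lambda=\sum_{i=1}^m\Lambda_i\varepsilon_i+\sum_{\mu=1}^n\Lambda_\mu\delta_\mu$, with $\varepsilon_{m+\mu}:=\delta_\mu$. Bilinear form $(\Lambda,\Lambda')=\sum_i\Lambda_i\Lambda'_i-\sum_\mu\Lambda_\mu\Lambda'_\mu$, $\rho=\frac12\sum_{j=1}^m(m-n-2j+1)\varepsilon_j+\frac12\sum_{\nu=1}^n(m+n-2\nu+1)\delta_\nu$, and $\chi_\mu(I_2)=(\mu,\mu+2\rho)$ (the eigenvalue of the quadratic Casimir $I_2=\sum_{p,q}(-1)^{(q)}E_{pq}E_{qp}$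 on the irreducible module of highest weight $\mu$). The roots are $\alpha_i=\Lambda_i+m-n-i$ ($1\le i\le m$), $\alpha_{m+\mu}=\mu-\Lambda_\mu-n$ ($1\le\mu\le n$). A maximal weight vector is a weight vector annihilated by all $E_{pq}$, $p<q$. *)

theory Defs
  imports Complex_Main
begin

(* A finite-dimensional gl(m|n)-supermodule, presented by a finite homogeneous
   basis indexed by idx, the parity of each basis vector (True = odd), and the
   matrices of the generators E_pq (1 <= p,q <= m+n): mat p q i j is the
   i-th coordinate of E_pq applied to the j-th basis vector. Vectors are
   coordinate functions 'i => complex vanishing outside idx. *)
record 'i smod =
  idx :: "'i set"
  par :: "'i \<Rightarrow> bool"
  mat :: "nat \<Rightarrow> nat \<Rightarrow> 'i \<Rightarrow> 'i \<Rightarrow> complex"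

(* parity (p) of an index p : False = 0 (p <= m), True = 1 *)
definition pty :: "nat \<Rightarrow> nat \<Rightarrow> bool" where
  "pty m p = (m < p)"

definition sgn1 :: "bool \<Rightarrow> complex" where
  "sgn1 b = (if b then -1 else 1)"

definition epar :: "nat \<Rightarrow> nat \<Rightarrow> nat \<Rightarrow> bool" where
  "epar m p q = (pty m p \<noteq> pty m q)"

definition rng :: "nat \<Rightarrow> nat \<Rightarrow> nat set" where
  "rng m n = {1..m+n}"

definition vecs :: "('i, 'z) smod_scheme \<Rightarrow> ('i \<Rightarrow> complex) set" where
  "vecs M = {x. \<forall>i. i \<notin> idx M \<longrightarrow> x i = 0}"

definition act :: "('i, 'z) smod_scheme \<Rightarrow> nat \<Rightarrow> nat \<Rightarrow> ('i \<Rightarrow> complex) \<Rightarrow> ('i \<Rightarrow> complex)" where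
  "act M p q x = (\<lambda>i. \<Sum>j\<in>idx M. mat M p q i j * x j)"

definition is_module :: "nat \<Rightarrow> nat \<Rightarrow> ('i, 'z) smod_scheme \<Rightarrow> bool" where
  "is_module m n M \<longleftrightarrow>
     finite (idx M) \<and>
     (\<forall>p q i j. mat M p q i j \<noteq> 0 \<longrightarrow> i \<in> idx M \<and> j \<in> idx M) \<and>
     (\<forall>p\<in>rng m n. \<forall>q\<in>rng m n. \<forall>i j. mat M p q i j \<noteq> 0 \<longrightarrow>
          par M i = (par M j \<noteq> epar m p q)) \<and>
     (\<forall>p\<in>rng m n. \<forall>q\<in>rng m n. \<forall>r\<in>rng m n. \<forall>s\<in>rng m n. \<forall>x\<in>vecs M.
        (\<lambda>i. act M p q (act M r s x) i
              - sgn1 (epar m p q \<and> epar m r s) * act M r s (act M p q x) i)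
        = (\<lambda>i. (if q = r then act M p s x i else 0)
              - sgn1 (epar m p q \<and> epar m r s) * (if p = s then act M r q x i else 0)))"

definition submodule :: "nat \<Rightarrow> nat \<Rightarrow> ('i, 'z) smod_scheme \<Rightarrow> ('i \<Rightarrow> complex) set \<Rightarrow> bool" where
  "submodule m n M U \<longleftrightarrow>
     U \<subseteq> vecs M \<and> (\<lambda>i. 0) \<in> U \<and>
     (\<forall>x\<in>U. \<forall>y\<in>U. (\<lambda>i. x i + y i) \<in> U) \<and>
     (\<forall>c. \<forall>x\<in>U. (\<lambda>i. c * x i) \<in> U) \<and>
     (\<forall>p\<in>rng m n. \<forall>q\<in>rng m n. \<forall>x\<in>U. act M p q x \<in> U) \<and>
     (\<forall>x\<in>U. (\<lambda>i. if par M i then 0 else x i) \<in> U)"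

definition irreducible_mod :: "nat \<Rightarrow> nat \<Rightarrow> ('i, 'z) smod_scheme \<Rightarrow> bool" where
  "irreducible_mod m n M \<longleftrightarrow> idx M \<noteq> {} \<and>
     (\<forall>U. submodule m n M U \<longrightarrow> U = {\<lambda>i. 0} \<or> U = vecs M)"

definition completely_reducible :: "nat \<Rightarrow> nat \<Rightarrow> ('i, 'z) smod_scheme \<Rightarrow> bool" where
  "completely_reducible m n M \<longleftrightarrow>
     (\<forall>U. submodule m n M U \<longrightarrow>
        (\<exists>U'. submodule m n M U' \<and> U \<inter> U' = {\<lambda>i. 0} \<and>
              (\<forall>x\<in>vecs M. \<exists>u\<in>U. \<exists>u'\<in>U'. x = (\<lambda>i. u i + u' i))))"

(* weights: functions on indices 1..m+n (Lambda_i, i<=m; Lambda_mu at index m+mu) *)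
definition weight_vector :: "nat \<Rightarrow> nat \<Rightarrow> ('i, 'z) smod_scheme \<Rightarrow> (nat \<Rightarrow> complex) \<Rightarrow> ('i \<Rightarrow> complex) \<Rightarrow> bool" where
  "weight_vector m n M \<mu> x \<longleftrightarrow> x \<in> vecs M \<and> x \<noteq> (\<lambda>i. 0) \<and>
     (\<forall>p\<in>rng m n. act M p p x = (\<lambda>i. \<mu> p * x i))"

definition maximal_vector :: "nat \<Rightarrow> nat \<Rightarrow> ('i, 'z) smod_scheme \<Rightarrow> (nat \<Rightarrow> complex) \<Rightarrow> ('i \<Rightarrow> complex) \<Rightarrow> bool" where
  "maximal_vector m n M \<mu> x \<longleftrightarrow> weight_vector m n M \<mu> x \<and>
     (\<forall>p\<in>rng m n. \<forall>q\<in>rng m n. p < q \<longrightarrow> act M p q x = (\<lambda>i. 0))"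

definition irrep_hw :: "nat \<Rightarrow> nat \<Rightarrow> ('i, 'z) smod_scheme \<Rightarrow> (nat \<Rightarrow> complex) \<Rightarrow> bool" where
  "irrep_hw m n M \<Lambda> \<longleftrightarrow> is_module m n M \<and> irreducible_mod m n M \<and>
     (\<exists>x. maximal_vector m n M \<Lambda> x)"

definition vecmod :: "nat \<Rightarrow> nat \<Rightarrow> nat smod" where
  "vecmod m n = \<lparr> idx = rng m n, par = pty m,
     mat = (\<lambda>p q t s. if t \<in> rng m n \<and> s \<in> rng m n \<and> t = p \<and> s = q then 1 else 0) \<rparr>"

(* dual module, on the dual basis <s| (same parities):
   (E_pq f)(v) = -(-1)^(((p)+(q))|f|) f(E_pq v) *)
definition dualmod :: "nat \<Rightarrow> ('i, 'z) smod_scheme \<Rightarrow> 'i smod" where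
  "dualmod m M = \<lparr> idx = idx M, par = par M,
     mat = (\<lambda>p q t s. - sgn1 (epar m p q \<and> par M s) * mat M p q s t) \<rparr>"

(* graded tensor product: X(a (x) b) = Xa (x) b + (-1)^(|X||a|) a (x) Xb *)
definition tensormod :: "nat \<Rightarrow> ('i, 'z) smod_scheme \<Rightarrow> ('j, 'w) smod_scheme \<Rightarrow> ('i \<times> 'j) smod" where
  "tensormod m M N = \<lparr> idx = idx M \<times> idx N,
     par = (\<lambda>(a, b). par M a \<noteq> par N b),
     mat = (\<lambda>p q (a, b) (c, d).
              (if b = d \<and> b \<in> idx N then mat M p q a c else 0)
            + (if a = c \<and> a \<in> idx M then sgn1 (epar m p q \<and> par M c) * mat N p q b d else 0)) \<rparr>"

definition eps :: "nat \<Rightarrow> nat \<Rightarrow> complex" where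
  "eps r = (\<lambda>i. if i = r then 1 else 0)"

definition bform :: "nat \<Rightarrow> nat \<Rightarrow> (nat \<Rightarrow> complex) \<Rightarrow> (nat \<Rightarrow> complex) \<Rightarrow> complex" where
  "bform m n L L' = (\<Sum>i=1..m. L i * L' i) - (\<Sum>\<mu>=1..n. L (m+\<mu>) * L' (m+\<mu>))"

definition rho :: "nat \<Rightarrow> nat \<Rightarrow> nat \<Rightarrow> complex" where
  "rho m n k = (if 1 \<le> k \<and> k \<le> m then (of_int (int m - int n - 2 * int k + 1)) / 2
               else if m < k \<and> k \<le> m + n then (of_int (int m + int n - 2 * int (k - m) + 1)) / 2
               else 0)"

definition chi2 :: "nat \<Rightarrow> nat \<Rightarrow> (nat \<Rightarrow> complex) \<Rightarrow> complex" where
  "chi2 m n \<mu> = bform m n \<mu> (\<lambda>k. \<mu> k + 2 * rho m n k)"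

end

theory Submission
  imports Defs "HOL-Library.Function_Algebras"
begin

text \<open>
  Let \<open>w\<close> be a homogeneous maximal vector of \<open>V(\<Lambda>)\<close> and \<open>\<langle>s|\<close> the basis of \<open>V\<^sup>*\<close>. For a vector
  \<open>x = \<Sum>\<^sub>s \<langle>s| \<otimes> x\<^sub>s\<close> killed by all \<open>E\<^sub>p\<^sub>q\<close> with \<open>p < q\<close>, the first nonzero component \<open>x\<^sub>r\<close> is killed by
  them as well, hence is a multiple of \<open>w\<close>. So a maximal vector has some weight \<open>\<Lambda> - \<epsilon>\<^sub>r\<close>, is determined
  by it up to a scalar, and every nonzero submodule contains one: take a vector with the largest
  possible \<open>r\<close>.

  Modulo the submodule generated by the \<open>\<langle>s| \<otimes> w\<close> with \<open>s > k\<close>, the vector \<open>\<langle>k| \<otimes> w\<close> is maximal of weight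
  \<open>\<Lambda> - \<epsilon>\<^sub>k\<close>, hence an eigenvector of the Casimir operator for \<open>\<chi>\<^sub>k\<close>. As the \<open>\<chi>\<^sub>k\<close> are distinct, downward
  induction on \<open>k\<close> corrects it to a genuine eigenvector \<open>u\<^sub>k\<close>, which is zero or maximal, and the \<open>u\<^sub>k\<close>
  generate the module. A submodule \<open>U\<close> is then complemented by the sum of the eigenspaces for those
  \<open>\<chi>\<^sub>k\<close> for which \<open>U\<close> contains no maximal vector of weight \<open>\<Lambda> - \<epsilon>\<^sub>k\<close>.
\<close>

section \<open>Sums of eigenvectors in spaces of functions\<close>

definition scl :: "complex \<Rightarrow> ('i \<Rightarrow> complex) \<Rightarrow> 'i \<Rightarrow> complex" (infixr "\<cdot>" 75) where
  "c \<cdot> x = (\<lambda>i. c * x i)"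

lemma scl_apply: "(c \<cdot> x) i = c * x i"
  by (simp add: scl_def)

lemma sum_fun_apply: "(sum f A) i = (\<Sum>a\<in>A. f a i)"
  by (induction A rule: infinite_finite_induct) auto

lemmas pointwise = plus_fun_apply zero_fun_apply minus_apply uminus_apply scl_apply sum_fun_apply

(* Otherwise the simplifier takes apart vectors that unification has eta-expanded. *)
declare plus_fun_apply [simp del] zero_fun_apply [simp del] minus_apply [simp del] uminus_apply [simp del]

interpretation fvs: vector_space "(\<cdot>) :: complex \<Rightarrow> ('i \<Rightarrow> complex) \<Rightarrow> _"
  by unfold_locales (auto simp: fun_eq_iff pointwise algebra_simps)

definition lin :: "(('i \<Rightarrow> complex) \<Rightarrow> 'j \<Rightarrow> complex) \<Rightarrow> bool" where
  "lin F \<longleftrightarrow> (\<forall>x y. F (x + y) = F x + F y) \<and> (\<forall>c x. F (c \<cdot> x) = c \<cdot> F x)"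

lemma lin_add: "lin F \<Longrightarrow> F (x + y) = F x + F y"
  and lin_scale: "lin F \<Longrightarrow> F (c \<cdot> x) = c \<cdot> F x"
  by (auto simp: lin_def)

lemma lin_zero: "lin F \<Longrightarrow> F 0 = 0"
  using lin_scale[of F 0 0] by simp

lemma lin_neg: "lin F \<Longrightarrow> F (- x) = - F x"
  using lin_scale[of F "-1" x] by simp

lemma lin_diff: "lin F \<Longrightarrow> F (x - y) = F x - F y"
  using lin_add[of F x "- y"] lin_neg[of F y] by simp

lemma lin_sum:
  assumes "lin F"
  shows "F (sum f A) = (\<Sum>a\<in>A. F (f a))"
  by (induction A rule: infinite_finite_induct)
    (simp_all add: assms lin_zero[where F = F] lin_add[where F = F])

lemmas lin_simps = lin_add lin_scale lin_zero lin_neg lin_diff lin_sum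

text \<open>Applying \<open>F - \<chi> a\<close> to the sum stays in \<open>U\<close>, removes the
  component at \<open>a\<close> and multiplies the one at \<open>k\<close> by the nonzero number
  \<open>\<chi> k - \<chi> a\<close>. The induction hypothesis gives the other components, and
  subtracting them gives the one at \<open>a\<close>.\<close>

lemma eigencomponents_in_invariant_subspace:
  assumes F: "lin F" and U: "fvs.subspace U" and inv: "\<And>x. x \<in> U \<Longrightarrow> F x \<in> U"
    and J: "finite J" "inj_on \<chi> J"
    and y: "\<And>j. j \<in> J \<Longrightarrow> F (y j) = \<chi> j \<cdot> y j" and sum: "sum y J \<in> U"
    and j: "j \<in> J"
  shows "y j \<in> U"
  using J y sum j
proof (induction J arbitrary: y j rule: finite_induct)
  case (insert a J)
  let ?x = "sum y (insert a J)"
  define z where "z k = (\<chi> k - \<chi> a) \<cdot> y k" for k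
  have zs: "sum z J = F ?x - \<chi> a \<cdot> ?x"
    using insert.hyps insert.prems(2)
    by (simp add: F lin_simps[where F = F] z_def fvs.scale_right_distrib fvs.scale_sum_right
        fvs.scale_left_diff_distrib sum_subtractf cong: sum.cong)
  have "z k \<in> U" if "k \<in> J" for k
  proof (rule insert.IH[OF _ _ _ that])
    show "inj_on \<chi> J" using insert.prems(1) by auto
    show "F (z k) = \<chi> k \<cdot> z k" if "k \<in> J" for k
      using insert.prems(2)[of k] that by (simp add: z_def F lin_simps[where F = F] mult.commute)
    show "sum z J \<in> U"
      unfolding zs by (intro fvs.subspace_diff U inv fvs.subspace_scale insert.prems(3))
  qed
  then have 1: "y k \<in> U" if "k \<in> J" for k
  proof -
    have "\<chi> k \<noteq> \<chi> a" using insert.prems(1) insert.hyps that by (auto simp: inj_on_def)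
    then have "y k = inverse (\<chi> k - \<chi> a) \<cdot> z k" by (simp add: z_def)
    then show ?thesis using \<open>\<And>k. k \<in> J \<Longrightarrow> z k \<in> U\<close>[OF that] fvs.subspace_scale[OF U] by metis
  qed
  have "y a = ?x - sum y J" using insert.hyps by simp
  then have "y a \<in> U" using 1 insert.prems(3) by (metis U fvs.subspace_diff fvs.subspace_sum)
  with 1 insert.prems(4) show ?case by auto
qed simp

text \<open>Eigenspaces are indexed by \<open>J\<close> rather than by eigenvalues. A component may
  be zero, so \<open>\<chi> j\<close> need not occur as an eigenvalue.\<close>

definition eigensums ::
  "('i \<Rightarrow> complex) set \<Rightarrow> (('i \<Rightarrow> complex) \<Rightarrow> 'i \<Rightarrow> complex) \<Rightarrow> ('k \<Rightarrow> complex) \<Rightarrow> 'k set \<Rightarrow> ('i \<Rightarrow> complex) set"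
  where "eigensums V F \<chi> J = {sum y J |y. \<forall>j\<in>J. y j \<in> V \<and> F (y j) = \<chi> j \<cdot> y j}"

lemma eigensums_subset: "fvs.subspace V \<Longrightarrow> eigensums V F \<chi> J \<subseteq> V"
  by (auto simp: eigensums_def intro!: fvs.subspace_sum)

lemma subspace_eigensums:
  assumes "lin F" "fvs.subspace V"
  shows "fvs.subspace (eigensums V F \<chi> J)"
proof (rule fvs.subspaceI)
  show "0 \<in> eigensums V F \<chi> J"
    unfolding eigensums_def using assms
    by (auto intro!: exI[of _ "\<lambda>_. 0"] simp: fvs.subspace_0 assms(1) lin_zero[where F = F])
next
  fix x y assume "x \<in> eigensums V F \<chi> J" "y \<in> eigensums V F \<chi> J"
  then obtain a b where "x = sum a J" "y = sum b J"
    "\<forall>j\<in>J. a j \<in> V \<and> F (a j) = \<chi> j \<cdot> a j" "\<forall>j\<in>J. b j \<in> V \<and> F (b j) = \<chi> j \<cdot> b j"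
    by (auto simp: eigensums_def)
  then show "x + y \<in> eigensums V F \<chi> J"
    unfolding eigensums_def using assms
    by (auto intro!: exI[of _ "\<lambda>j. a j + b j"]
        simp: sum.distrib assms(1) lin_add[where F = F] fvs.subspace_add fvs.scale_right_distrib)
next
  fix c x assume "x \<in> eigensums V F \<chi> J"
  then obtain a where "x = sum a J" "\<forall>j\<in>J. a j \<in> V \<and> F (a j) = \<chi> j \<cdot> a j"
    by (auto simp: eigensums_def)
  then show "c \<cdot> x \<in> eigensums V F \<chi> J"
    unfolding eigensums_def using assms
    by (auto intro!: exI[of _ "\<lambda>j. c \<cdot> a j"]
        simp: fvs.scale_sum_right assms(1) lin_scale[where F = F] fvs.subspace_scale mult.commute)
qed

lemma eigensums_mono:
  assumes "lin F" "fvs.subspace V" "J \<subseteq> K" "finite K"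
  shows "eigensums V F \<chi> J \<subseteq> eigensums V F \<chi> K"
proof
  fix x assume "x \<in> eigensums V F \<chi> J"
  then obtain a where a: "x = sum a J" "\<forall>j\<in>J. a j \<in> V \<and> F (a j) = \<chi> j \<cdot> a j"
    by (auto simp: eigensums_def)
  let ?b = "\<lambda>k. if k \<in> J then a k else 0"
  have "x = sum ?b K"
    using assms(3,4) a(1) by (auto intro: sum.mono_neutral_cong_left)
  moreover have "\<forall>j\<in>K. ?b j \<in> V \<and> F (?b j) = \<chi> j \<cdot> ?b j"
    using a(2) assms(1,2) by (auto simp: assms(1) lin_zero[where F = F] fvs.subspace_0)
  ultimately show "x \<in> eigensums V F \<chi> K" unfolding eigensums_def by blast
qed

lemma eigenvector_in_eigensums:
  assumes "x \<in> V" "F x = \<chi> a \<cdot> x" "lin F" "fvs.subspace V" "a \<in> J" "finite J"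
  shows "x \<in> eigensums V F \<chi> J"
proof -
  have "x \<in> eigensums V F \<chi> {a}"
    unfolding eigensums_def using assms by (auto intro!: exI[of _ "\<lambda>_. x"])
  then show ?thesis using eigensums_mono[of F V "{a}" J] assms by auto
qed

text \<open>An expansion of \<open>x\<close> over \<open>J\<close> together with \<open>- x\<close>
  at the index \<open>a\<close> is a vanishing sum of eigenvectors for distinct eigenvalues; the
  preceding result applies with the invariant subspace \<open>{0}\<close>.\<close>

lemma eigenvector_notin_eigensums:
  assumes F: "lin F" and J: "finite J" "inj_on \<chi> (insert a J)" "a \<notin> J"
    and x: "F x = \<chi> a \<cdot> x" "x \<in> eigensums V F \<chi> J"
  shows "x = 0"
proof -
  obtain y where y: "x = sum y J" "\<forall>j\<in>J. y j \<in> V \<and> F (y j) = \<chi> j \<cdot> y j"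
    using x(2) by (auto simp: eigensums_def)
  define z where "z = y(a := - x)"
  have "sum z J = x" unfolding y(1) z_def using J by (intro sum.cong) auto
  then have z0: "sum z (insert a J) \<in> {0}" using J by (simp add: z_def)
  have zF: "F (z j) = \<chi> j \<cdot> z j" if "j \<in> insert a J" for j
  proof (cases "j = a")
    case True
    then show ?thesis by (simp add: z_def lin_neg[where F = F] F x(1))
  next
    case False
    with that y(2) show ?thesis by (simp add: z_def)
  qed
  have "z a \<in> {0}"
    by (rule eigencomponents_in_invariant_subspace[OF F _ _ _ J(2) zF z0])
      (use J in \<open>auto simp: lin_zero[where F = F] F\<close>)
  then show ?thesis by (simp add: z_def)
qed

lemma eigensums_closed:
  assumes "lin G" "\<And>x. x \<in> V \<Longrightarrow> G x \<in> V" "\<And>x. F (G x) = G (F x)"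
    "x \<in> eigensums V F \<chi> J"
  shows "G x \<in> eigensums V F \<chi> J"
proof -
  obtain a where "x = sum a J" "\<forall>j\<in>J. a j \<in> V \<and> F (a j) = \<chi> j \<cdot> a j"
    using assms by (auto simp: eigensums_def)
  then show ?thesis
    unfolding eigensums_def using assms(1-3)
    by (auto intro!: exI[of _ "\<lambda>j. G (a j)"] simp: lin_simps[where F = G])
qed

text \<open>The components of a vector of an invariant subspace \<open>U\<close> lie in
  \<open>U\<close> themselves. This later keeps a correction term inside a prescribed
  submodule.\<close>

lemma eigensums_restrict:
  assumes "lin F" "fvs.subspace U" "\<And>x. x \<in> U \<Longrightarrow> F x \<in> U" "finite J" "inj_on \<chi> J"
    "x \<in> U" "x \<in> eigensums V F \<chi> J"
  shows "x \<in> eigensums U F \<chi> J"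
proof -
  obtain a where a: "x = sum a J" "\<forall>j\<in>J. a j \<in> V \<and> F (a j) = \<chi> j \<cdot> a j"
    using assms by (auto simp: eigensums_def)
  have "a j \<in> U" if "j \<in> J" for j
    using eigencomponents_in_invariant_subspace[OF assms(1-5), of a j] a that assms(6) by auto
  with a show ?thesis by (auto simp: eigensums_def)
qed

section \<open>Modules, submodules and the Casimir operator\<close>

text \<open>Stability under this projection is what makes a subspace graded.\<close>

definition even_part :: "'i smod \<Rightarrow> ('i \<Rightarrow> complex) \<Rightarrow> 'i \<Rightarrow> complex" where
  "even_part M x = (\<lambda>i. if par M i then 0 else x i)"

lemma lin_even_part: "lin (even_part M)"
  by (auto simp: lin_def even_part_def fun_eq_iff pointwise)

lemma lin_act: "lin (act M p q)"
  by (auto simp: lin_def act_def fun_eq_iff pointwise algebra_simps sum.distrib sum_distrib_left)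

lemmas act_simps = lin_simps[where F = "act M p q" for M p q, OF lin_act]
lemmas even_part_simps = lin_simps[where F = "even_part M" for M, OF lin_even_part]

lemma subspace_vecs: "fvs.subspace (vecs M)"
  by (auto simp: fvs.subspace_def vecs_def pointwise)

lemma submodule_iff:
  "submodule m n M U \<longleftrightarrow> U \<subseteq> vecs M \<and> fvs.subspace U \<and>
     (\<forall>p\<in>rng m n. \<forall>q\<in>rng m n. \<forall>x\<in>U. act M p q x \<in> U) \<and> (\<forall>x\<in>U. even_part M x \<in> U)"
  unfolding submodule_def fvs.subspace_def even_part_def zero_fun_def plus_fun_def scl_def
  by blast

lemma finite_rng [simp]: "finite (rng m n)"
  by (simp add: rng_def)

lemma epar_self [simp]: "epar m p p = False"
  by (simp add: epar_def)

lemma sgn1_simps [simp]: "sgn1 False = 1" "sgn1 True = -1"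
  by (auto simp: sgn1_def)

lemma sgn1_sq [simp]: "sgn1 b * sgn1 b = 1" "sgn1 b * (sgn1 b * c) = c"
  by (auto simp: sgn1_def)

text \<open>Maximality without the conditions on weight and nonvanishing; such vectors form a
  subspace, so differences can be taken freely.\<close>

definition primitive :: "nat \<Rightarrow> nat \<Rightarrow> 'i smod \<Rightarrow> ('i \<Rightarrow> complex) \<Rightarrow> bool" where
  "primitive m n M x \<longleftrightarrow> x \<in> vecs M \<and> (\<forall>p\<in>rng m n. \<forall>q\<in>rng m n. p < q \<longrightarrow> act M p q x = 0)"

lemma maximal_vector_iff:
  "maximal_vector m n M \<mu> x \<longleftrightarrow>
     primitive m n M x \<and> x \<noteq> 0 \<and> (\<forall>p\<in>rng m n. act M p p x = \<mu> p \<cdot> x)"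
  unfolding maximal_vector_def weight_vector_def primitive_def zero_fun_def scl_def by blast

definition casimir :: "nat \<Rightarrow> nat \<Rightarrow> 'i smod \<Rightarrow> ('i \<Rightarrow> complex) \<Rightarrow> 'i \<Rightarrow> complex" where
  "casimir m n M x = (\<Sum>p\<in>rng m n. \<Sum>q\<in>rng m n. sgn1 (pty m q) \<cdot> act M p q (act M q p x))"

lemma lin_casimir: "lin (casimir m n M)"
  unfolding lin_def casimir_def
  by (simp add: act_simps fvs.scale_right_distrib sum.distrib
      fvs.scale_sum_right mult.commute)

definition generated :: "nat \<Rightarrow> nat \<Rightarrow> 'i smod \<Rightarrow> ('i \<Rightarrow> complex) set \<Rightarrow> ('i \<Rightarrow> complex) set" where
  "generated m n M A = \<Inter>{U. submodule m n M U \<and> A \<subseteq> U}"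

lemma generated_least: "submodule m n M U \<Longrightarrow> A \<subseteq> U \<Longrightarrow> generated m n M A \<subseteq> U"
  by (auto simp: generated_def)

lemma generated_inc: "x \<in> A \<Longrightarrow> x \<in> generated m n M A"
  by (auto simp: generated_def)

locale gl_module =
  fixes m n :: nat and M :: "'i smod"
  assumes is_mod: "is_module m n M"
begin

lemma finite_idx: "finite (idx M)"
  using is_mod by (simp add: is_module_def)

lemma act_in_vecs: "act M p q x \<in> vecs M"
proof -
  have "mat M p q i j = 0" if "i \<notin> idx M" for i j
    using is_mod that unfolding is_module_def by blast
  then show ?thesis by (auto simp: act_def vecs_def)
qed

lemma even_part_in_vecs: "x \<in> vecs M \<Longrightarrow> even_part M x \<in> vecs M"
  by (auto simp: even_part_def vecs_def)

lemma act_act: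
  assumes "p \<in> rng m n" "q \<in> rng m n" "r \<in> rng m n" "s \<in> rng m n"
  shows "act M p q (act M r s x) = sgn1 (epar m p q \<and> epar m r s) \<cdot> act M r s (act M p q x)
     + (if q = r then act M p s x else 0)
     - sgn1 (epar m p q \<and> epar m r s) \<cdot> (if p = s then act M r q x else 0)"
proof -
  \<comment> \<open>The bracket axiom speaks only of vectors supported on \<open>idx M\<close>.
    Truncating \<open>x\<close> does not change the action, which makes the rule valid for every
    \<open>x\<close>.\<close>
  define y where "y i = (if i \<in> idx M then x i else 0)" for i
  have y: "y \<in> vecs M" by (auto simp: y_def vecs_def)
  have a: "act M a b y = act M a b x" for a b
    by (auto simp: act_def y_def intro!: sum.cong)
  have "(\<lambda>i. act M p q (act M r s y) i - sgn1 (epar m p q \<and> epar m r s) * act M r s (act M p q y) i)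
     = (\<lambda>i. (if q = r then act M p s y i else 0)
          - sgn1 (epar m p q \<and> epar m r s) * (if p = s then act M r q y i else 0))"
    using is_mod assms y unfolding is_module_def by blast
  then show ?thesis
    unfolding a by (auto simp: fun_eq_iff pointwise algebra_simps)
qed

text \<open>An even generator commutes with the projection, while an odd one carries the even part
  of \<open>x\<close> to the odd part of the image.\<close>

lemma act_even_part:
  assumes "p \<in> rng m n" "q \<in> rng m n"
  shows "act M p q (even_part M x) =
     (if epar m p q then act M p q x - even_part M (act M p q x) else even_part M (act M p q x))"
proof -
  have z: "mat M p q i j = 0" if "par M i \<noteq> (par M j \<noteq> epar m p q)" for i j
    using is_mod assms that unfolding is_module_def by blast
  have e: "mat M p q i j * even_part M x j =
    (if par M i = epar m p q then mat M p q i j * x j else 0)" for i j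
    using z[of i j] by (cases "mat M p q i j = 0") (auto simp: even_part_def)
  have f: "act M p q (even_part M x) i = (if par M i = epar m p q then act M p q x i else 0)" for i
    unfolding act_def e by auto
  show ?thesis
    by (auto simp: fun_eq_iff pointwise f even_part_def[of M "act M p q x"])
qed

lemma casimir_even_part: "casimir m n M (even_part M x) = even_part M (casimir m n M x)"
proof -
  have "act M p q (act M q p (even_part M x)) = even_part M (act M p q (act M q p x))"
    if "p \<in> rng m n" "q \<in> rng m n" for p q
    using that by (auto simp: act_even_part act_simps epar_def)
  then show ?thesis
    by (simp add: casimir_def even_part_simps)
qed

text \<open>Moving \<open>E_rs\<close> through both factors of \<open>E_pq E_qp\<close> produces the
  same sign twice, hence no sign, and four commutator terms. After summation these cancel in
  pairs.\<close>

lemma casimir_act: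
  assumes rs: "r \<in> rng m n" "s \<in> rng m n"
  shows "casimir m n M (act M r s x) = act M r s (casimir m n M x)"
proof -
  let ?R = "rng m n" and ?\<sigma> = "\<lambda>p q. sgn1 (epar m r s \<and> epar m p q)"
  let ?E = "act M"
  have sw: "epar m q p = epar m p q" for p q by (auto simp: epar_def)
  have step: "?E r s (?E p q (?E q p x)) = ?E p q (?E q p (?E r s x))
     + (if s = p then ?E r q (?E q p x) else 0)
     - (if r = q then ?\<sigma> p q \<cdot> ?E p s (?E q p x) else 0)
     + (if s = q then ?\<sigma> p q \<cdot> ?E p q (?E r p x) else 0)
     - (if r = p then ?E p q (?E q s x) else 0)"
    if "p \<in> ?R" "q \<in> ?R" for p q
    unfolding act_act[OF rs that] act_act[OF rs that(2,1)] sw[of q p]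
    by (auto simp: act_simps fvs.scale_right_distrib fvs.scale_right_diff_distrib
        algebra_simps)
  have "act M r s (casimir m n M x) - casimir m n M (act M r s x) =
    (\<Sum>p\<in>?R. \<Sum>q\<in>?R. sgn1 (pty m q) \<cdot> (?E r s (?E p q (?E q p x)) - ?E p q (?E q p (?E r s x))))"
    by (simp add: casimir_def act_simps sum_subtractf fvs.scale_right_diff_distrib)
  also have "\<dots> = (\<Sum>p\<in>?R. \<Sum>q\<in>?R.
       (if s = p then sgn1 (pty m q) \<cdot> ?E r q (?E q p x) else 0)
     - (if r = q then (sgn1 (pty m q) * ?\<sigma> p q) \<cdot> ?E p s (?E q p x) else 0)
     + (if s = q then (sgn1 (pty m q) * ?\<sigma> p q) \<cdot> ?E p q (?E r p x) else 0)
     - (if r = p then sgn1 (pty m q) \<cdot> ?E p q (?E q s x) else 0))"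
    by (intro sum.cong refl, subst step) (auto simp: fvs.scale_right_distrib fvs.scale_right_diff_distrib)
  also have "\<dots> = (\<Sum>q\<in>?R. sgn1 (pty m q) \<cdot> ?E r q (?E q s x))
     - (\<Sum>p\<in>?R. (sgn1 (pty m r) * ?\<sigma> p r) \<cdot> ?E p s (?E r p x))
     + (\<Sum>p\<in>?R. (sgn1 (pty m s) * ?\<sigma> p s) \<cdot> ?E p s (?E r p x))
     - (\<Sum>q\<in>?R. sgn1 (pty m q) \<cdot> ?E r q (?E q s x))"
  proof -
    have sw1: "(\<Sum>p\<in>?R. \<Sum>q\<in>?R. if a = p then f p q else 0) = (\<Sum>q\<in>?R. f a q)"
      if "a \<in> ?R" for a and f :: "nat \<Rightarrow> nat \<Rightarrow> 'i \<Rightarrow> complex"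
    proof -
      have "(\<Sum>p\<in>?R. \<Sum>q\<in>?R. if a = p then f p q else 0) = (\<Sum>p\<in>?R. if a = p then \<Sum>q\<in>?R. f p q else 0)"
        by (intro sum.cong) auto
      then show ?thesis using that by simp
    qed
    show ?thesis
      unfolding sum.distrib sum_subtractf using rs by (simp add: sw1)
  qed
  \<comment> \<open>The signs agree: if \<open>r\<close> and \<open>s\<close> have different
    parities, then exactly one of \<open>epar m p r\<close> and \<open>epar m p s\<close> holds,
    which compensates the difference between the signs of \<open>r\<close> and
    \<open>s\<close>.\<close>
  also have "(\<Sum>p\<in>?R. (sgn1 (pty m r) * ?\<sigma> p r) \<cdot> ?E p s (?E r p x))
     = (\<Sum>p\<in>?R. (sgn1 (pty m s) * ?\<sigma> p s) \<cdot> ?E p s (?E r p x))"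
    by (intro sum.cong refl arg_cong2[where f = scl])
      (auto simp: epar_def sgn1_def)
  finally show ?thesis by simp
qed

lemma submodule_vecs: "submodule m n M (vecs M)"
  by (auto simp: submodule_iff subspace_vecs act_in_vecs even_part_in_vecs)

lemma submodule_generated:
  assumes "A \<subseteq> vecs M"
  shows "submodule m n M (generated m n M A)"
proof -
  have "generated m n M A \<subseteq> vecs M"
    using submodule_vecs assms by (rule generated_least)
  moreover have "fvs.subspace (generated m n M A)"
    unfolding generated_def by (intro fvs.subspace_Inter) (auto simp: submodule_iff)
  ultimately show ?thesis
    by (auto simp: submodule_iff generated_def)
qed

lemma submodule_casimir: "submodule m n M U \<Longrightarrow> x \<in> U \<Longrightarrow> casimir m n M x \<in> U"
  unfolding casimir_def
  by (intro fvs.subspace_sum fvs.subspace_scale) (auto simp: submodule_iff)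

text \<open>The Casimir operator commutes with all generators and with the parity projection, so
  each of its eigenspaces is a graded submodule.\<close>

lemma submodule_casimir_eigensums:
  "submodule m n M (eigensums (vecs M) (casimir m n M) \<chi> J)"
  unfolding submodule_iff
  by (auto simp: eigensums_subset[OF subspace_vecs, THEN subsetD]
      subspace_eigensums[OF lin_casimir subspace_vecs]
      intro!: eigensums_closed[OF lin_act act_in_vecs] eigensums_closed[OF lin_even_part even_part_in_vecs]
      casimir_act casimir_even_part)

end

section \<open>The Casimir eigenvalue attached to a highest weight\<close>

lemma sum_sgn1_pty:
  "(\<Sum>q=1..p. sgn1 (pty m q)) = (if p \<le> m then of_nat p else 2 * of_nat m - of_nat p)"
proof (induction p)
  case (Suc p)
  have "(\<Sum>q=1..Suc p. sgn1 (pty m q)) = (\<Sum>q=1..p. sgn1 (pty m q)) + sgn1 (pty m (Suc p))"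
    by simp
  then show ?case
    unfolding Suc.IH by (cases "p = m") (auto simp: pty_def)
qed simp

text \<open>The form in which \<open>rho\<close> arises from reordering the Casimir operator: every
  index after \<open>p\<close> contributes its sign positively and every index before
  \<open>p\<close> negatively.\<close>

lemma sgn1_rho:
  assumes p: "p \<in> rng m n"
  shows "(\<Sum>q\<in>rng m n. ((if p < q then 1 else 0) - (if q < p then 1 else 0)) * sgn1 (pty m q))
    = sgn1 (pty m p) * (2 * rho m n p)"
proof -
  let ?s = "\<lambda>q. sgn1 (pty m q)"
  have p': "1 \<le> p" "p \<le> m + n" using p by (auto simp: rng_def)
  \<comment> \<open>A general upper bound \<open>N\<close> permits induction. The last term is
    needed because the doubled sum also contains \<open>q = p\<close>, whose coefficient on the left
    is zero.\<close>
  have split: "(\<Sum>q=1..N. ((if p < q then 1 else 0) - (if q < p then 1 else 0)) * ?s q)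
    = (\<Sum>q=1..N. ?s q) - 2 * (\<Sum>q=1..min p N. ?s q) + (if p \<le> N then ?s p else 0)" for N
  proof (induction N)
    case (Suc N)
    consider "p \<le> N" | "p = Suc N" | "p > Suc N" by linarith
    then show ?case using Suc p'(1) by cases (auto simp: algebra_simps min_def)
  qed (use p' in simp)
  have "(\<Sum>q\<in>rng m n. ((if p < q then 1 else 0) - (if q < p then 1 else 0)) * ?s q)
    = (\<Sum>q=1..m+n. ?s q) - 2 * (\<Sum>q=1..p. ?s q) + ?s p"
    unfolding rng_def split using p' by (simp add: min_def)
  also have "\<dots> = sgn1 (pty m p) * (2 * rho m n p)"
    unfolding sum_sgn1_pty using p'
    by (cases "p \<le> m") (auto simp: pty_def rho_def of_nat_diff algebra_simps)
  finally show ?thesis .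
qed

text \<open>Written as a double sum, the eigenvalue can be compared with the Casimir operator
  summand by summand: the diagonal pairs give the squares, and the pairs \<open>p < q\<close> give
  the commutators of \<open>E_pq\<close> and \<open>E_qp\<close>.\<close>

lemma chi2_eq:
  "chi2 m n \<mu> = (\<Sum>p\<in>rng m n. \<Sum>q\<in>rng m n. (if p = q then sgn1 (pty m p) * (\<mu> p * \<mu> p) else 0)
     + (if p < q then sgn1 (pty m q) * \<mu> p - sgn1 (pty m p) * \<mu> q else 0))"
proof -
  let ?R = "rng m n" and ?s = "\<lambda>q. sgn1 (pty m q)"
  have "chi2 m n \<mu> = (\<Sum>p\<in>{1..m} \<union> {m+1..m+n}. ?s p * (\<mu> p * (\<mu> p + 2 * rho m n p)))"
  proof -
    have "(\<Sum>\<nu>=1..n. \<mu> (m+\<nu>) * (\<mu> (m+\<nu>) + 2 * rho m n (m+\<nu>)))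
      = (\<Sum>p=m+1..m+n. \<mu> p * (\<mu> p + 2 * rho m n p))"
      by (rule sum.reindex_bij_witness[of _ "\<lambda>p. p - m" "\<lambda>\<nu>. m + \<nu>"]) auto
    then show ?thesis
      unfolding chi2_def bform_def
      by (subst sum.union_disjoint) (auto simp: pty_def sum_negf)
  qed
  also have "{1..m} \<union> {m+1..m+n} = ?R" by (auto simp: rng_def)
  also have "(\<Sum>p\<in>?R. ?s p * (\<mu> p * (\<mu> p + 2 * rho m n p)))
    = (\<Sum>p\<in>?R. ?s p * (\<mu> p * \<mu> p)
        + \<mu> p * (\<Sum>q\<in>?R. ((if p < q then 1 else 0) - (if q < p then 1 else 0)) * ?s q))"
    by (intro sum.cong refl, subst sgn1_rho) (simp_all add: algebra_simps)
  also have "\<dots> = (\<Sum>p\<in>?R. ?s p * (\<mu> p * \<mu> p))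
     + (\<Sum>p\<in>?R. \<Sum>q\<in>?R. (if p < q then ?s q * \<mu> p else 0))
     - (\<Sum>p\<in>?R. \<Sum>q\<in>?R. (if q < p then ?s q * \<mu> p else 0))"
    unfolding sum.distrib[symmetric] sum_subtractf[symmetric] sum_distrib_left add_diff_eq[symmetric]
    by (intro sum.cong refl arg_cong2[where f = "(+)"]) auto
  also have "(\<Sum>p\<in>?R. \<Sum>q\<in>?R. (if q < p then ?s q * \<mu> p else 0))
    = (\<Sum>p\<in>?R. \<Sum>q\<in>?R. (if p < q then ?s p * \<mu> q else 0))"
    by (rule sum.swap)
  also have "(\<Sum>p\<in>?R. ?s p * (\<mu> p * \<mu> p)) = (\<Sum>p\<in>?R. \<Sum>q\<in>?R. if p = q then ?s p * (\<mu> p * \<mu> p) else 0)"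
    by (intro sum.cong) auto
  finally show ?thesis
    unfolding sum.distrib[symmetric] sum_subtractf[symmetric]
    by (auto intro!: sum.cong)
qed

context gl_module
begin

text \<open>
  Stated modulo a submodule, because it is needed for vectors that are maximal only in a quotient.
\<close>

lemma casimir_highest_weight_mod:
  assumes U: "submodule m n M U"
    and raise: "\<And>p q. p \<in> rng m n \<Longrightarrow> q \<in> rng m n \<Longrightarrow> p < q \<Longrightarrow> act M p q t \<in> U"
    and weight: "\<And>p. p \<in> rng m n \<Longrightarrow> act M p p t - \<mu> p \<cdot> t \<in> U"
  shows "casimir m n M t - chi2 m n \<mu> \<cdot> t \<in> U"
proof -
  let ?R = "rng m n" and ?s = "\<lambda>q. sgn1 (pty m q)"
  let ?c = "\<lambda>p q. (if p = q then ?s p * (\<mu> p * \<mu> p) else 0)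
     + (if p < q then ?s q * \<mu> p - ?s p * \<mu> q else 0)"
  have sub: "fvs.subspace U" and inv: "\<And>p q x. p \<in> ?R \<Longrightarrow> q \<in> ?R \<Longrightarrow> x \<in> U \<Longrightarrow> act M p q x \<in> U"
    using U by (auto simp: submodule_iff)
  have "?s q \<cdot> act M p q (act M q p t) - ?c p q \<cdot> t \<in> U" if pq: "p \<in> ?R" "q \<in> ?R" for p q
  proof -
    consider "p = q" | "p < q" | "q < p" by linarith
    then show ?thesis
    proof cases
      case 1
      \<comment> \<open>Factorization of a difference of squares, with \<open>E_pp - \<mu> p\<close>
        acting first so that \<open>weight\<close> applies.\<close>
      have eq: "?s q \<cdot> act M p q (act M q p t) - ?c p q \<cdot> t
        = ?s p \<cdot> (act M p p (act M p p t - \<mu> p \<cdot> t) + \<mu> p \<cdot> (act M p p t - \<mu> p \<cdot> t))"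
        using 1 by (simp add: act_simps fvs.scale_right_diff_distrib fvs.scale_right_distrib)
      show ?thesis unfolding eq
        by (intro fvs.subspace_add[OF sub] fvs.subspace_scale[OF sub] inv weight pq)
    next
      case 2
      have e: "epar m q p = epar m p q" by (auto simp: epar_def)
      have s: "?s q * sgn1 (epar m p q) = ?s p" by (auto simp: epar_def sgn1_def)
      \<comment> \<open>Reordering puts the raising operator next to \<open>t\<close>, where it
        lands in \<open>U\<close>; the commutator leaves the two diagonal terms.\<close>
      have "?s q \<cdot> act M p q (act M q p t) =
         ?s p \<cdot> act M q p (act M p q t) + ?s q \<cdot> act M p p t - ?s p \<cdot> act M q q t"
        unfolding act_act[OF pq pq(2,1)]
        by (simp add: fvs.scale_right_diff_distrib fvs.scale_right_distrib e s)
      then have eq: "?s q \<cdot> act M p q (act M q p t) - ?c p q \<cdot> t =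
         ?s p \<cdot> act M q p (act M p q t) + ?s q \<cdot> (act M p p t - \<mu> p \<cdot> t)
          - ?s p \<cdot> (act M q q t - \<mu> q \<cdot> t)"
        using 2 by (simp add: fvs.scale_right_diff_distrib fvs.scale_left_diff_distrib)
      show ?thesis unfolding eq
        by (rule fvs.subspace_diff[OF sub])
          (intro fvs.subspace_add[OF sub] fvs.subspace_scale[OF sub] inv weight raise pq 2)+
    next
      case 3
      then show ?thesis using pq by (simp add: fvs.subspace_scale[OF sub] inv raise)
    qed
  qed
  then have "(\<Sum>p\<in>?R. \<Sum>q\<in>?R. ?s q \<cdot> act M p q (act M q p t) - ?c p q \<cdot> t) \<in> U"
    by (intro fvs.subspace_sum sub)
  then show ?thesis
    unfolding chi2_eq casimir_def sum_subtractf fvs.scale_sum_left .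
qed

text \<open>
  The vectors reached from \<open>B\<close> by lowering operators \<open>E\<^sub>p\<^sub>q\<close>, \<open>p > q\<close>, of total height \<open>\<Sum>(p - q) \<le> D\<close>;
  allowing negative \<open>D\<close>, where only 0 remains, lets raising operators decrease \<open>D\<close> without case
  distinctions.
\<close>

inductive lowered :: "('i \<Rightarrow> complex) set \<Rightarrow> int \<Rightarrow> ('i \<Rightarrow> complex) \<Rightarrow> bool" for B where
  zero: "lowered B D 0"
| base: "x \<in> B \<Longrightarrow> 0 \<le> D \<Longrightarrow> lowered B D x"
| lower: "lowered B D x \<Longrightarrow> p \<in> rng m n \<Longrightarrow> q \<in> rng m n \<Longrightarrow> q < p \<Longrightarrow> D + int p - int q \<le> D'
    \<Longrightarrow> lowered B D' (act M p q x)"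
| add: "lowered B D x \<Longrightarrow> lowered B D y \<Longrightarrow> lowered B D (x + y)"
| scale: "lowered B D x \<Longrightarrow> lowered B D (c \<cdot> x)"

lemma lowered_mono: "lowered B D x \<Longrightarrow> D \<le> D' \<Longrightarrow> lowered B D' x"
proof (induction arbitrary: D' rule: lowered.induct)
  case (lower D x p q D1)
  then show ?case by (intro lowered.lower[OF lower.hyps(1)]) auto
qed (auto intro: lowered.intros)

lemma lowered_diff: "lowered B D x \<Longrightarrow> lowered B D y \<Longrightarrow> lowered B D (x - y)"
  using lowered.add[OF _ lowered.scale[of B D y "-1"]] by fastforce

lemma lowered_neg: "lowered B D x \<Longrightarrow> D < 0 \<Longrightarrow> x = 0"
  by (induction rule: lowered.induct) (auto simp: act_simps)

text \<open>A generator is commuted inwards past the lowering operators until it meets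
  \<open>B\<close>, where raising gives zero and diagonal generators stay in \<open>B\<close>. The
  commutators involve other generators, so the induction keeps \<open>a\<close> and \<open>b\<close>
  arbitrary.\<close>

lemma lowered_act:
  assumes B: "\<And>x. x \<in> B \<Longrightarrow> primitive m n M x" "\<And>x a. x \<in> B \<Longrightarrow> a \<in> rng m n \<Longrightarrow> act M a a x \<in> B"
    and "lowered B D x" "a \<in> rng m n" "b \<in> rng m n"
  shows "lowered B (D + int a - int b) (act M a b x)"
  using assms(3-5)
proof (induction arbitrary: a b rule: lowered.induct)
  case (zero D)
  then show ?case by (simp add: act_simps lowered.zero)
next
  case (base x D)
  consider "a = b" | "a < b" | "b < a" by linarith
  then show ?case
  proof cases
    case 1 then show ?thesis using base B(2) by (auto intro: lowered.base)
  next
    case 2 then show ?thesis using base B(1)[of x] by (auto simp: primitive_def lowered.zero)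
  next
    case 3 then show ?thesis using base by (auto intro!: lowered.lower[OF lowered.base])
  qed
next
  case (lower D x p q D')
  have 1: "lowered B (D' + int a - int b) (act M p q (act M a b x))"
    using lower by (intro lowered.lower[OF lower.IH[of a b]]) auto
  have 2: "lowered B (D' + int a - int b) (if b = p then act M a q x else 0)"
    using lower.hyps lower.prems lowered_mono[OF lower.IH[of a q]] by (auto intro: lowered.zero)
  have 3: "lowered B (D' + int a - int b) (if a = q then act M p b x else 0)"
    using lower.hyps lower.prems lowered_mono[OF lower.IH[of p b]] by (auto intro: lowered.zero)
  show ?case
    unfolding act_act[OF lower.prems lower.hyps(2,3)]
    by (intro lowered_diff lowered.add lowered.scale 1 2 3)
next
  case (add D x y)
  then show ?case by (simp add: act_simps lowered.add)
next
  case (scale D x c)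
  then show ?case by (simp add: act_simps lowered.scale)
qed

lemma lowered_even_part:
  assumes "\<And>x. x \<in> B \<Longrightarrow> even_part M x \<in> B" "lowered B D x"
  shows "lowered B D (even_part M x)"
  using assms(2)
proof (induction rule: lowered.induct)
  case (lower D x p q D')
  have "even_part M (act M p q x) =
    (if epar m p q then act M p q x - act M p q (even_part M x) else act M p q (even_part M x))"
    using act_even_part[OF lower.hyps(2,3), of x] by auto
  moreover have "lowered B D' (act M p q x)" "lowered B D' (act M p q (even_part M x))"
    using lower by (auto intro: lowered.lower)
  ultimately show ?case by (auto intro: lowered_diff)
qed (auto simp: even_part_simps assms(1) intro: lowered.intros)

text \<open>Starting from primitive vectors, lowering operators alone already reach a whole
  submodule. This is applied both to the multiples of a highest weight vector and to sets of
  primitive vectors of lower height.\<close>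

lemma submodule_lowered:
  assumes "\<And>x. x \<in> B \<Longrightarrow> primitive m n M x" "\<And>x a. x \<in> B \<Longrightarrow> a \<in> rng m n \<Longrightarrow> act M a a x \<in> B"
    "\<And>x. x \<in> B \<Longrightarrow> even_part M x \<in> B"
  shows "submodule m n M {x. \<exists>D. lowered B D x}"
proof -
  have "x \<in> vecs M" if "lowered B D x" for D x
    using that
    by induction (use assms(1) subspace_vecs[of M] in
        \<open>auto simp: act_in_vecs primitive_def fvs.subspace_0 fvs.subspace_add fvs.subspace_scale\<close>)
  moreover have "\<exists>D. lowered B D (x + y)" if "lowered B D x" "lowered B D' y" for x y D D'
    using lowered_mono[OF that(1), of "max D D'"] lowered_mono[OF that(2), of "max D D'"]
    by (auto intro: lowered.add)
  ultimately show ?thesis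
    unfolding submodule_iff fvs.subspace_def
    by (auto intro: lowered.zero lowered.scale lowered_act[of B] assms lowered_even_part)
qed

section \<open>Operations on primitive vectors and the grading by height\<close>

lemma primitive_act_diag:
  assumes "primitive m n M x" "a \<in> rng m n"
  shows "primitive m n M (act M a a x)"
  unfolding primitive_def
proof (intro conjI ballI impI act_in_vecs)
  fix p q assume pq: "p \<in> rng m n" "q \<in> rng m n" "p < q"
  then have "act M p q x = 0" using assms(1) by (simp add: primitive_def)
  then show "act M p q (act M a a x) = 0"
    unfolding act_act[OF pq(1,2) assms(2,2)] by (auto simp: act_simps)
qed

lemma primitive_even_part:
  "primitive m n M x \<Longrightarrow> primitive m n M (even_part M x)"
  by (auto simp: primitive_def act_even_part even_part_simps even_part_in_vecs)

lemma primitive_diff: "primitive m n M x \<Longrightarrow> primitive m n M y \<Longrightarrow> primitive m n M (x - y)"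
  by (auto simp: primitive_def act_simps fvs.subspace_diff[OF subspace_vecs])

lemma primitive_scale: "primitive m n M x \<Longrightarrow> primitive m n M (c \<cdot> x)"
  by (auto simp: primitive_def act_simps fvs.subspace_scale[OF subspace_vecs])

text \<open>The diagonal element whose commutator with \<open>E_ab\<close> is
  \<open>(a - b) E_ab\<close>, in accordance with the height counted by
  \<open>lowered\<close>.\<close>

definition height :: "('i \<Rightarrow> complex) \<Rightarrow> 'i \<Rightarrow> complex" where
  "height x = (\<Sum>p\<in>rng m n. of_nat p \<cdot> act M p p x)"

lemma lin_height: "lin height"
  unfolding lin_def height_def
  by (simp add: act_simps fvs.scale_right_distrib sum.distrib fvs.scale_sum_right mult.commute)

lemma height_act:
  assumes "a \<in> rng m n" "b \<in> rng m n"
  shows "height (act M a b x) = act M a b (height x) + (of_nat a - of_nat b) \<cdot> act M a b x"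
proof -
  have "height (act M a b x) = (\<Sum>p\<in>rng m n. of_nat p \<cdot> act M a b (act M p p x)
      + (if p = a then of_nat p \<cdot> act M a b x else 0) - (if p = b then of_nat p \<cdot> act M a b x else 0))"
    unfolding height_def
    by (intro sum.cong refl) (auto simp: act_act[OF _ _ assms] fvs.scale_right_distrib fvs.scale_right_diff_distrib)
  also have "\<dots> = act M a b (height x) + (of_nat a - of_nat b) \<cdot> act M a b x"
    using assms
    by (simp add: sum.distrib sum_subtractf height_def act_simps fvs.scale_left_diff_distrib)
  finally show ?thesis .
qed

lemma height_even_part: "height (even_part M x) = even_part M (height x)"
  by (simp add: height_def even_part_simps act_even_part)

end

section \<open>The tensor product with the dual vector module\<close>

text \<open>The component \<open>x_s\<close> in the expansion of \<open>x\<close> as the sum of all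
  \<open><s|\<close> tensor \<open>x_s\<close>.\<close>

definition slice :: "('a \<times> 'i \<Rightarrow> complex) \<Rightarrow> 'a \<Rightarrow> 'i \<Rightarrow> complex" where
  "slice x s = (\<lambda>i. x (s, i))"

lemma slice_eqI: "(\<And>s. slice x s = slice y s) \<Longrightarrow> x = y"
  by (auto simp: slice_def fun_eq_iff)

lemma slice_simps:
  "slice (x + y) s = slice x s + slice y s" "slice (x - y) s = slice x s - slice y s"
  "slice (c \<cdot> x) s = c \<cdot> slice x s" "slice 0 s = 0" "slice (- x) s = - slice x s"
  by (auto simp: slice_def fun_eq_iff pointwise)

definition pure_tensor :: "'a \<Rightarrow> ('i \<Rightarrow> complex) \<Rightarrow> 'a \<times> 'i \<Rightarrow> complex" where
  "pure_tensor s y = (\<lambda>(t, i). if t = s then y i else 0)"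

lemma slice_pure_tensor: "slice (pure_tensor s y) t = (if t = s then y else 0)"
  by (auto simp: slice_def pure_tensor_def fun_eq_iff pointwise)

lemma lin_pure_tensor: "lin (pure_tensor s)"
  by (auto simp: lin_def pure_tensor_def fun_eq_iff pointwise)

lemmas pure_tensor_simps =
  lin_simps[where F = "pure_tensor s" for s, OF lin_pure_tensor]

abbreviation dual_tensor :: "nat \<Rightarrow> nat \<Rightarrow> 'i smod \<Rightarrow> (nat \<times> 'i) smod" where
  "dual_tensor m n W \<equiv> tensormod m (dualmod m (vecmod m n)) W"

lemma vecs_dual_tensor_iff:
  "x \<in> vecs (dual_tensor m n W) \<longleftrightarrow>
     (\<forall>s. slice x s \<in> vecs W) \<and> (\<forall>s. s \<notin> rng m n \<longrightarrow> slice x s = 0)"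
  by (auto simp: vecs_def tensormod_def dualmod_def vecmod_def slice_def fun_eq_iff pointwise)

lemma par_dual_tensor: "par (dual_tensor m n W) (t, i) = (pty m t \<noteq> par W i)"
  by (simp add: tensormod_def dualmod_def vecmod_def)

lemma mat_dual_tensor:
  assumes "p \<in> rng m n" "q \<in> rng m n"
  shows "mat (dual_tensor m n W) p q (t, i) (c, d) =
     (if i = d \<and> i \<in> idx W \<and> c = p \<and> t = q then - sgn1 (epar m p q \<and> pty m p) else 0)
     + (if t = c \<and> t \<in> rng m n then sgn1 (epar m p q \<and> pty m t) * mat W p q i d else 0)"
  using assms by (auto simp: tensormod_def dualmod_def vecmod_def)

text \<open>On the dual basis \<open>E_pq\<close> sends \<open><p|\<close> to a multiple of
  \<open><q|\<close> and kills the rest, so only the slice at \<open>q\<close> receives a foreign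
  contribution. The other sign comes from moving \<open>E_pq\<close> past
  \<open><t|\<close>.\<close>

lemma slice_act:
  assumes W: "is_module m n W" and pq: "p \<in> rng m n" "q \<in> rng m n"
    and x: "x \<in> vecs (dual_tensor m n W)"
  shows "slice (act (dual_tensor m n W) p q x) t =
     (if t = q then - sgn1 (epar m p q \<and> pty m p) \<cdot> slice x p else 0)
     + sgn1 (epar m p q \<and> pty m t) \<cdot> act W p q (slice x t)"
proof
  fix i
  have fin: "finite (idx W)" using W by (simp add: is_module_def)
  have x0: "x (t, i) = 0" if "t \<notin> rng m n \<or> i \<notin> idx W" for t i
    using x that by (auto simp: vecs_def tensormod_def dualmod_def vecmod_def)
  have idx: "idx (dual_tensor m n W) = rng m n \<times> idx W"
    by (simp add: tensormod_def dualmod_def vecmod_def)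
  have "act (dual_tensor m n W) p q x (t, i)
    = (\<Sum>c\<in>rng m n. \<Sum>d\<in>idx W. mat (dual_tensor m n W) p q (t, i) (c, d) * x (c, d))"
    unfolding act_def idx by (simp add: sum.cartesian_product)
  also have "\<dots> = (\<Sum>c\<in>rng m n. \<Sum>d\<in>idx W.
       (if d = i then if c = p then if t = q then - sgn1 (epar m p q \<and> pty m p) * x (p, i) else 0 else 0 else 0)
     + (if c = t then sgn1 (epar m p q \<and> pty m t) * (mat W p q i d * x (t, d)) else 0))"
    unfolding mat_dual_tensor[OF pq] by (intro sum.cong refl) (auto simp: algebra_simps)
  also have "\<dots> = (if t = q then - sgn1 (epar m p q \<and> pty m p) * x (p, i) else 0)
     + sgn1 (epar m p q \<and> pty m t) * act W p q (slice x t) i"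
  proof -
    have "(\<Sum>c\<in>rng m n. \<Sum>d\<in>idx W. if c = t then sgn1 (epar m p q \<and> pty m t) * (mat W p q i d * x (t, d)) else 0)
      = (\<Sum>c\<in>rng m n. if c = t then sgn1 (epar m p q \<and> pty m t) * act W p q (slice x t) i else 0)"
      by (intro sum.cong refl) (auto simp: act_def slice_def sum_distrib_left)
    also have "\<dots> = sgn1 (epar m p q \<and> pty m t) * act W p q (slice x t) i"
      using x0[of t] by (auto simp: act_def slice_def)
    finally show ?thesis
      using pq fin x0[of p i] by (cases "i \<in> idx W"; cases "t = q") (simp_all add: sum.distrib)
  qed
  finally show "slice (act (dual_tensor m n W) p q x) t i =
     ((if t = q then - sgn1 (epar m p q \<and> pty m p) \<cdot> slice x p else 0)
     + sgn1 (epar m p q \<and> pty m t) \<cdot> act W p q (slice x t)) i"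
    by (auto simp: slice_def pointwise)
qed

lemma is_module_dual_tensor:
  assumes W: "is_module m n W"
  shows "is_module m n (dual_tensor m n W)"
proof -
  interpret gl_module m n W using W by unfold_locales
  let ?T = "dual_tensor m n W" and ?R = "rng m n"
  have supp: "i \<in> idx W \<and> j \<in> idx W" if "mat W p q i j \<noteq> 0" for p q i j
    using W that unfolding is_module_def by blast
  have parW: "par W i = (par W j \<noteq> epar m p q)"
    if "mat W p q i j \<noteq> 0" "p \<in> ?R" "q \<in> ?R" for p q i j
    using W that unfolding is_module_def by blast
  have 1: "finite (idx ?T)"
    using finite_idx by (simp add: tensormod_def dualmod_def vecmod_def)
  have 2: "a \<in> idx ?T \<and> b \<in> idx ?T" if "mat ?T p q a b \<noteq> 0" for p q a b
    using that supp[of p q "snd a" "snd b"]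
    by (cases a; cases b) (auto simp: tensormod_def dualmod_def vecmod_def split: if_splits)
  have 3: "par ?T a = (par ?T b \<noteq> epar m p q)"
    if "p \<in> ?R" "q \<in> ?R" "mat ?T p q a b \<noteq> 0" for p q a b
  proof -
    obtain t i c d where ab: "a = (t, i)" "b = (c, d)" by (cases a; cases b) auto
    show ?thesis
      using that(3) parW[of p q i d] that(1,2) unfolding ab mat_dual_tensor[OF that(1,2)] par_dual_tensor
      by (auto simp: epar_def split: if_splits)
  qed
  have vec: "act ?T p q x \<in> vecs ?T" if "p \<in> ?R" "q \<in> ?R" "x \<in> vecs ?T" for p q x
    using that unfolding vecs_dual_tensor_iff slice_act[OF W that]
    by (auto simp: act_simps intro!: fvs.subspace_add[OF subspace_vecs] fvs.subspace_scale[OF subspace_vecs]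
        fvs.subspace_diff[OF subspace_vecs] fvs.subspace_0[OF subspace_vecs] act_in_vecs)
  have 4: "act ?T p q (act ?T r s x) - sgn1 (epar m p q \<and> epar m r s) \<cdot> act ?T r s (act ?T p q x)
    = (if q = r then act ?T p s x else 0) - sgn1 (epar m p q \<and> epar m r s) \<cdot> (if p = s then act ?T r q x else 0)"
    (is "?lhs = ?rhs") if R: "p \<in> ?R" "q \<in> ?R" "r \<in> ?R" "s \<in> ?R" and x: "x \<in> vecs ?T" for p q r s x
  proof (rule slice_eqI)
    fix t
    note sl = slice_act[OF W R(1,2) vec[OF R(3,4) x]] slice_act[OF W R(3,4) vec[OF R(1,2) x]]
      slice_act[OF W R(1,2) x] slice_act[OF W R(3,4) x] slice_act[OF W R(1,4) x] slice_act[OF W R(3,2) x]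
    have if_slice: "slice (if b then y else 0) t = (if b then slice y t else 0)" for b and y :: "nat \<times> 'a \<Rightarrow> complex"
      by (simp add: slice_simps)
    \<comment> \<open>Once the bracket relation of \<open>W\<close> has been used, what remains is
      an identity of signs in the parities of five indices.\<close>
    show "slice ?lhs t = slice ?rhs t"
      unfolding slice_simps if_slice sl act_simps
      unfolding act_act[OF R, of "slice x t"]
      by (cases "pty m p"; cases "pty m q"; cases "pty m r"; cases "pty m s"; cases "pty m t")
        (auto simp: epar_def act_simps fvs.scale_right_distrib fvs.scale_right_diff_distrib)
  qed
  have 5: "(\<lambda>i. act ?T p q (act ?T r s x) i - sgn1 (epar m p q \<and> epar m r s) * act ?T r s (act ?T p q x) i)
        = (\<lambda>i. (if q = r then act ?T p s x i else 0)
              - sgn1 (epar m p q \<and> epar m r s) * (if p = s then act ?T r q x i else 0))"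
    if R: "p \<in> ?R" "q \<in> ?R" "r \<in> ?R" "s \<in> ?R" and x: "x \<in> vecs ?T" for p q r s x
  proof
    fix i
    show "act ?T p q (act ?T r s x) i - sgn1 (epar m p q \<and> epar m r s) * act ?T r s (act ?T p q x) i
        = (if q = r then act ?T p s x i else 0)
              - sgn1 (epar m p q \<and> epar m r s) * (if p = s then act ?T r q x i else 0)"
      using fun_cong[OF 4[OF that], of i] by (auto simp: pointwise)
  qed
  show ?thesis
    unfolding is_module_def using 1 2 3 5 by blast
qed

section \<open>Primitive vectors of an irreducible module\<close>

text \<open>Homogeneity keeps the multiples of \<open>w\<close> stable under
  \<open>even_part\<close>, so that lowering them yields a graded subspace.\<close>

locale highest_weight_irrep = gl_module m n W for m n and W :: "'i smod" +
  fixes \<Lambda> :: "nat \<Rightarrow> complex" and w :: "'i \<Rightarrow> complex"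
  assumes irreducible: "irreducible_mod m n W"
    and maximal: "maximal_vector m n W \<Lambda> w"
    and homogeneous: "even_part W w = w \<or> even_part W w = 0"
begin

lemma w_in_vecs: "w \<in> vecs W" and w_nonzero: "w \<noteq> 0" and w_primitive: "primitive m n W w"
  and w_weight: "p \<in> rng m n \<Longrightarrow> act W p p w = \<Lambda> p \<cdot> w"
  using maximal by (auto simp: maximal_vector_iff primitive_def)

lemma submodule_trivial: "submodule m n W U \<Longrightarrow> x \<in> U \<Longrightarrow> x \<noteq> 0 \<Longrightarrow> U = vecs W"
  using irreducible unfolding irreducible_mod_def zero_fun_def by blast

text \<open>All multiples of \<open>w\<close> are taken as base because
  \<open>submodule_lowered\<close> asks for a base stable under diagonal generators and
  \<open>even_part\<close>.\<close>

abbreviation degree_le :: "int \<Rightarrow> ('i \<Rightarrow> complex) \<Rightarrow> bool" where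
  "degree_le \<equiv> lowered (range (\<lambda>c. c \<cdot> w))"

lemma degree_le_act:
  "degree_le D x \<Longrightarrow> a \<in> rng m n \<Longrightarrow> b \<in> rng m n \<Longrightarrow> degree_le (D + int a - int b) (act W a b x)"
  by (rule lowered_act) (auto simp: primitive_scale w_primitive act_simps w_weight)

text \<open>The vectors reached from \<open>w\<close> by lowering form a submodule containing
  \<open>w\<close>, which by irreducibility is everything.\<close>

lemma degree_le_exhausts:
  assumes "x \<in> vecs W"
  shows "\<exists>D. degree_le D x"
proof -
  have "{x. \<exists>D. degree_le D x} = vecs W"
  proof (rule submodule_trivial[OF _ _ w_nonzero])
    show "submodule m n W {x. \<exists>D. degree_le D x}"
      by (rule submodule_lowered)
        (use homogeneous in \<open>auto simp: primitive_scale w_primitive act_simps w_weight even_part_simps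
            intro: range_eqI[of _ _ 0]\<close>)
    show "w \<in> {x. \<exists>D. degree_le D x}"
      by (auto intro!: exI[of _ 0] lowered.base intro: range_eqI[of _ _ 1])
  qed
  then show ?thesis using assms by blast
qed

section \<open>The subspace below the highest weight vector\<close>

abbreviation top_height :: complex where
  "top_height \<equiv> \<Sum>p\<in>rng m n. of_nat p * \<Lambda> p"

text \<open>
  Since \<open>[height, E\<^sub>p\<^sub>q] = (p - q) E\<^sub>p\<^sub>q\<close>, lowering increases the eigenvalue of \<^term>\<open>height\<close>; this separates
  \<^term>\<open>w\<close> from everything properly below it.
\<close>

definition below :: "('i \<Rightarrow> complex) set" where
  "below = (\<Union>D. eigensums (vecs W) height (\<lambda>d. top_height + of_nat d) {1..D::nat})"

lemma height_w: "height w = top_height \<cdot> w"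
  by (simp add: height_def w_weight fvs.scale_sum_left)

lemma eigenvector_in_below:
  assumes "x \<in> vecs W" "height x = (top_height + of_nat d) \<cdot> x" "1 \<le> d"
  shows "x \<in> below"
  unfolding below_def using assms
  by (auto intro!: exI[of _ d] eigenvector_in_eigensums[where a = d] lin_height subspace_vecs)

lemma subspace_below: "fvs.subspace below"
proof -
  let ?E = "\<lambda>D. eigensums (vecs W) height (\<lambda>d. top_height + of_nat d) {1..D::nat}"
  have sub: "fvs.subspace (?E D)" for D
    by (intro subspace_eigensums lin_height subspace_vecs)
  have mono: "?E D \<subseteq> ?E D'" if "D \<le> D'" for D D'
    using that by (intro eigensums_mono lin_height subspace_vecs) auto
  show ?thesis
  proof (rule fvs.subspaceI)
    show "0 \<in> below" using fvs.subspace_0[OF sub] by (auto simp: below_def)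
    show "c \<cdot> x \<in> below" if "x \<in> below" for c x
      using that fvs.subspace_scale[OF sub] by (auto simp: below_def)
    fix x y assume "x \<in> below" "y \<in> below"
    then obtain D D' where "x \<in> ?E D" "y \<in> ?E D'" by (auto simp: below_def)
    then have "x \<in> ?E (max D D')" "y \<in> ?E (max D D')"
      using mono[of D "max D D'"] mono[of D' "max D D'"] by auto
    then show "x + y \<in> below" using fvs.subspace_add[OF sub] unfolding below_def by blast
  qed
qed

lemma below_act:
  assumes x: "x \<in> below" and ab: "a \<in> rng m n" "b \<in> rng m n" "b \<le> a"
  shows "act W a b x \<in> below"
proof -
  obtain D y where y: "x = sum y {1..D::nat}"
    "\<forall>d\<in>{1..D}. y d \<in> vecs W \<and> height (y d) = (top_height + of_nat d) \<cdot> y d"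
    using x by (auto simp: below_def eigensums_def)
  have "act W a b (y d) \<in> below" if "d \<in> {1..D}" for d
  proof (rule eigenvector_in_below[OF act_in_vecs])
    show "height (act W a b (y d)) = (top_height + of_nat (d + (a - b))) \<cdot> act W a b (y d)"
      using y(2) that ab
      by (simp add: height_act act_simps of_nat_diff fvs.scale_left_distrib fvs.scale_left_diff_distrib)
    show "1 \<le> d + (a - b)" using that by auto
  qed
  then show ?thesis
    unfolding y(1) act_simps by (intro fvs.subspace_sum subspace_below)
qed

lemma below_even_part: "x \<in> below \<Longrightarrow> even_part W x \<in> below"
  unfolding below_def
  using eigensums_closed[where F = height, OF lin_even_part _ height_even_part] even_part_in_vecs by blast

lemma w_notin_below: "w \<notin> below"
proof
  assume "w \<in> below"
  then obtain D where "w \<in> eigensums (vecs W) height (\<lambda>d. top_height + of_nat d) {1..D::nat}"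
    by (auto simp: below_def)
  then have "w = 0"
    \<comment> \<open>The index 0 stands for the height of \<open>w\<close> itself, which the range
      \<open>{1..D}\<close> leaves out.\<close>
    by (rule eigenvector_notin_eigensums[where a = "0::nat", rotated -1])
      (auto simp: lin_height inj_on_def height_w)
  then show False using w_nonzero by simp
qed

text \<open>A lowering operator sends both \<open>w\<close> and \<open>below\<close> into
  \<open>below\<close>. With \<open>degree_le_exhausts\<close> this makes \<open>W\<close> the sum
  of \<open>below\<close> and the line through \<open>w\<close>.\<close>

lemma degree_le_decomp: "degree_le D x \<Longrightarrow> \<exists>c. \<exists>z\<in>below. x = c \<cdot> w + z"
proof (induction rule: lowered.induct)
  case (zero D)
  then show ?case by (intro exI[of _ 0] bexI[of _ 0]) (auto simp: fvs.subspace_0[OF subspace_below])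
next
  case (base x D)
  then obtain c where "x = c \<cdot> w" by auto
  then show ?case by (intro exI[of _ c] bexI[of _ 0]) (auto simp: fvs.subspace_0[OF subspace_below])
next
  case (lower D x p q D')
  then obtain c z where z: "z \<in> below" "x = c \<cdot> w + z" by auto
  have "act W p q w \<in> below"
  proof (rule eigenvector_in_below[OF act_in_vecs])
    show "height (act W p q w) = (top_height + of_nat (p - q)) \<cdot> act W p q w"
      using lower.hyps by (simp add: height_act height_w act_simps of_nat_diff fvs.scale_left_distrib)
  qed (use lower.hyps in auto)
  then have "act W p q x \<in> below"
    using z below_act[of z p q] lower.hyps
    by (simp add: act_simps fvs.subspace_add[OF subspace_below] fvs.subspace_scale[OF subspace_below])
  then show ?case by (intro exI[of _ 0] bexI[of _ "act W p q x"]) auto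
next
  case (add D x y)
  then obtain c z c' z' where "z \<in> below" "x = c \<cdot> w + z" "z' \<in> below" "y = c' \<cdot> w + z'" by blast
  then show ?case
    by (intro exI[of _ "c + c'"] bexI[of _ "z + z'"])
      (auto simp: fvs.scale_left_distrib fvs.subspace_add[OF subspace_below])
next
  case (scale D x b)
  then obtain c z where "z \<in> below" "x = c \<cdot> w + z" by blast
  then show ?case
    by (intro exI[of _ "b * c"] bexI[of _ "b \<cdot> z"])
      (auto simp: fvs.scale_right_distrib fvs.subspace_scale[OF subspace_below])
qed

text \<open>Lowering and diagonal generators preserve \<open>below\<close>, so the submodule
  obtained by lowering the primitive vectors of \<open>below\<close> stays inside it. If it were
  nonzero, it would be all of \<open>W\<close> and contain \<open>w\<close>.\<close>

lemma primitive_in_below: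
  assumes "primitive m n W x" "x \<in> below"
  shows "x = 0"
proof (rule ccontr)
  assume "x \<noteq> 0"
  define B where "B = {x \<in> below. primitive m n W x}"
  have "submodule m n W {x. \<exists>D. lowered B D x}"
    by (rule submodule_lowered)
      (auto simp: B_def below_act primitive_act_diag below_even_part primitive_even_part)
  moreover have "x \<in> {x. \<exists>D. lowered B D x}"
    using assms by (auto simp: B_def intro!: exI[of _ 0] lowered.base)
  ultimately have "{x. \<exists>D. lowered B D x} = vecs W"
    using \<open>x \<noteq> 0\<close> by (rule submodule_trivial)
  then obtain D where "lowered B D w" using w_in_vecs by blast
  then have "w \<in> below"
  proof induction
    case (lower D x p q D')
    then show ?case by (auto intro: below_act)
  qed (auto simp: B_def fvs.subspace_0[OF subspace_below] fvs.subspace_add[OF subspace_below]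
      fvs.subspace_scale[OF subspace_below])
  then show False using w_notin_below by simp
qed

text \<open>Removing the multiple of \<open>w\<close> leaves a vector that is still primitive and
  lies in \<open>below\<close>, hence vanishes.\<close>

lemma primitive_unique:
  assumes "primitive m n W x"
  shows "\<exists>c. x = c \<cdot> w"
proof -
  obtain D where "degree_le D x" using degree_le_exhausts assms unfolding primitive_def by blast
  then obtain c z where z: "z \<in> below" "x = c \<cdot> w + z" using degree_le_decomp by blast
  then have "z = x - c \<cdot> w" by simp
  then have "primitive m n W z" using assms w_primitive by (simp add: primitive_diff primitive_scale)
  then have "z = 0" using z(1) by (rule primitive_in_below)
  then show ?thesis using z(2) by auto
qed

end

section \<open>Maximal vectors of the tensor product\<close>

context highest_weight_irrep
begin

abbreviation T :: "(nat \<times> 'i) smod" where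
  "T \<equiv> dual_tensor m n W"

lemmas slice_act_T = slice_act[OF is_mod]

sublocale T: gl_module m n T
  using is_module_dual_tensor[OF is_mod] by unfold_locales

lemma slice_act_diag:
  assumes "p \<in> rng m n" "x \<in> vecs T"
  shows "slice (act T p p x) t = act W p p (slice x t) - (if t = p then slice x t else 0)"
  using slice_act_T[OF assms(1,1,2), of t] by auto

lemma first_slice:
  assumes "x \<in> vecs T" "x \<noteq> 0"
  obtains r where "r \<in> rng m n" "slice x r \<noteq> 0" "\<And>s. s < r \<Longrightarrow> slice x s = 0"
proof -
  let ?r = "LEAST s. slice x s \<noteq> 0"
  have "\<exists>s. slice x s \<noteq> 0" using assms(2) slice_eqI[of x 0] by (auto simp: slice_simps)
  then have r: "slice x ?r \<noteq> 0" by (rule LeastI_ex)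
  moreover have "?r \<in> rng m n" using r assms(1) unfolding vecs_dual_tensor_iff by blast
  ultimately show ?thesis using not_less_Least that by blast
qed

text \<open>The slice at \<open>r\<close> of \<open>E_pq x\<close> is \<open>E_pq\<close> applied to
  the slice of \<open>x\<close> up to sign, plus, if \<open>q = r\<close>, a multiple of the slice
  at \<open>p < r\<close>, which is zero.\<close>

lemma first_slice_primitive:
  assumes x: "primitive m n T x" and r: "r \<in> rng m n" and z: "\<And>s. s < r \<Longrightarrow> slice x s = 0"
  shows "\<exists>c. slice x r = c \<cdot> w"
proof (rule primitive_unique)
  have xT: "x \<in> vecs T" using x by (simp add: primitive_def)
  show "primitive m n W (slice x r)"
    unfolding primitive_def
  proof (intro conjI ballI impI)
    show "slice x r \<in> vecs W" using xT by (simp add: vecs_dual_tensor_iff)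
    fix p q assume pq: "p \<in> rng m n" "q \<in> rng m n" "p < q"
    then have "slice (act T p q x) r = 0" using x by (simp add: primitive_def slice_simps)
    moreover have "slice x p = 0" if "q = r" using z pq that by simp
    ultimately show "act W p q (slice x r) = 0"
      unfolding slice_act_T[OF pq(1,2) xT] by (auto simp: sgn1_def split: if_splits)
  qed
qed

lemma slice_weight:
  assumes "p \<in> rng m n" "x \<in> vecs T" "slice x r = c \<cdot> w"
  shows "slice (act T p p x) r = (\<Lambda> p - eps r p) \<cdot> slice x r"
  using assms by (auto simp: slice_act_diag act_simps w_weight eps_def fvs.scale_left_diff_distrib
      right_diff_distrib mult.commute)

text \<open>The first nonzero slice is a multiple of \<open>w\<close>, so the weight can be read off
  there; \<open><r|\<close> contributes \<open>- eps r\<close>.\<close>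

lemma maximal_first_slice:
  assumes "maximal_vector m n T \<mu> x"
  shows "\<exists>r\<in>rng m n. \<exists>c. c \<noteq> 0 \<and> slice x r = c \<cdot> w \<and> (\<forall>s<r. slice x s = 0) \<and>
    (\<forall>k\<in>rng m n. \<mu> k = \<Lambda> k - eps r k)"
proof -
  have x: "primitive m n T x" "x \<in> vecs T" "x \<noteq> 0" and wt: "\<And>p. p \<in> rng m n \<Longrightarrow> act T p p x = \<mu> p \<cdot> x"
    using assms by (auto simp: maximal_vector_iff primitive_def)
  obtain r where r: "r \<in> rng m n" "slice x r \<noteq> 0" "\<And>s. s < r \<Longrightarrow> slice x s = 0"
    using first_slice[OF x(2,3)] by blast
  obtain c where c: "slice x r = c \<cdot> w" using first_slice_primitive[OF x(1) r(1,3)] by blast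
  have "\<mu> k = \<Lambda> k - eps r k" if "k \<in> rng m n" for k
  proof -
    have "\<mu> k \<cdot> slice x r = (\<Lambda> k - eps r k) \<cdot> slice x r"
      using slice_weight[OF that x(2) c] wt[OF that] by (simp add: slice_simps)
    then show ?thesis using r(2) by simp
  qed
  moreover have "c \<noteq> 0" using r(2) c by auto
  ultimately show ?thesis using r(1,3) c by blast
qed

text \<open>The weight determines the position \<open>r\<close> of the first nonzero slice.
  Subtracting a multiple of \<open>x\<close> kills the slice of \<open>y\<close> at
  \<open>r\<close>; a nonzero difference would be maximal of the same weight and so have a nonzero
  slice at \<open>r\<close>.\<close>

lemma maximal_unique:
  assumes x: "maximal_vector m n T \<mu> x" and y: "maximal_vector m n T \<mu> y"
  shows "\<exists>c. y = c \<cdot> x"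
proof -
  obtain r c where r: "r \<in> rng m n" "c \<noteq> 0" "slice x r = c \<cdot> w" "\<forall>s<r. slice x s = 0"
    and \<mu>: "\<forall>k\<in>rng m n. \<mu> k = \<Lambda> k - eps r k"
    using maximal_first_slice[OF x] by blast
  have same: "r = s" if "\<forall>k\<in>rng m n. \<mu> k = \<Lambda> k - eps s k" for s
    using that \<mu> r(1) by (auto simp: eps_def split: if_splits)
  obtain d where d: "slice y r = d \<cdot> w" "\<forall>s<r. slice y s = 0"
    using maximal_first_slice[OF y] same by blast
  define z where "z = y - (d / c) \<cdot> x"
  have zr: "slice z s = 0" if "s \<le> r" for s
    using that by (cases "s = r") (simp_all add: z_def slice_simps r d)
  have "z = 0"
  proof (rule ccontr)
    assume "z \<noteq> 0"
    have "act T p p z = \<mu> p \<cdot> z" if "p \<in> rng m n" for p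
      using x y that unfolding maximal_vector_iff
      by (simp add: z_def act_simps fvs.scale_right_diff_distrib mult.commute)
    moreover have "primitive m n T z"
      using x y unfolding z_def maximal_vector_iff by (intro T.primitive_diff T.primitive_scale) auto
    ultimately have "maximal_vector m n T \<mu> z"
      using \<open>z \<noteq> 0\<close> by (simp add: maximal_vector_iff)
    then obtain b where "b \<noteq> 0" "slice z r = b \<cdot> w"
      using maximal_first_slice[of \<mu> z] same by blast
    then show False using zr[of r] w_nonzero by simp
  qed
  then have "y = (d / c) \<cdot> x" by (simp add: z_def)
  then show ?thesis by blast
qed

text \<open>Raising operators strictly decrease the bound \<open>k\<close> in \<open>P\<close>, so a
  nonzero vector of \<open>U\<close> with least \<open>k\<close> is annihilated by all of
  them.\<close>

lemma exists_primitive_in_submodule: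
  assumes U: "submodule m n T U" and y: "y \<in> U" "y \<noteq> 0"
  shows "\<exists>x\<in>U. x \<noteq> 0 \<and> primitive m n T x"
proof -
  have UT: "U \<subseteq> vecs T" and inv: "\<And>p q x. p \<in> rng m n \<Longrightarrow> q \<in> rng m n \<Longrightarrow> x \<in> U \<Longrightarrow> act T p q x \<in> U"
    using U by (auto simp: submodule_iff)
  (* The degree bound of the slice at s is shifted by s, because E_pq moves <p| to <q|. *)
  define P where "P k x \<longleftrightarrow> x \<in> U \<and> x \<noteq> 0 \<and> (\<forall>s. degree_le (int k - int (m + n) - 1 + int s) (slice x s))"
    for k and x :: "nat \<times> 'i \<Rightarrow> complex"
  have "\<exists>k. P k y"
  proof -
    have "\<forall>s. \<exists>D. degree_le D (slice y s)"
      using UT y(1) degree_le_exhausts by (auto simp: vecs_dual_tensor_iff)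
    then obtain f where f: "\<And>s. degree_le (f s) (slice y s)" by metis
    \<comment> \<open>The sum of absolute values dominates every \<open>f s\<close>, and
      \<open>m + n + 1\<close> cancels the shift in \<open>P\<close>.\<close>
    define k where "k = nat (\<Sum>s\<in>rng m n. \<bar>f s\<bar>) + m + n + 1"
    have "degree_le (int k - int (m + n) - 1 + int s) (slice y s)" for s
    proof (cases "s \<in> rng m n")
      case True
      have "\<bar>f s\<bar> \<le> (\<Sum>s\<in>rng m n. \<bar>f s\<bar>)" using True by (intro member_le_sum) auto
      then have "f s \<le> int k - int (m + n) - 1 + int s" by (simp add: k_def sum_nonneg)
      then show ?thesis using lowered_mono[OF f] by blast
    next
      case False
      then have "slice y s = 0" using UT y(1) by (auto simp: vecs_dual_tensor_iff)
      then show ?thesis by (simp add: lowered.zero)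
    qed
    then show ?thesis using y unfolding P_def by blast
  qed
  then have ex: "\<exists>k. \<exists>x. P k x" by blast
  define k where "k = (LEAST k. \<exists>x. P k x)"
  obtain x where "P k x" using LeastI_ex[OF ex] unfolding k_def by blast
  then have x: "x \<in> U" "x \<noteq> 0" "x \<in> vecs T"
    and deg: "\<And>s. degree_le (int k - int (m + n) - 1 + int s) (slice x s)"
    using UT by (auto simp: P_def)
  \<comment> \<open>For \<open>k = 0\<close> the bound at \<open>s\<close> is
    \<open>s - (m + n) - 1\<close>, negative for every \<open>s\<close> up to \<open>m + n\<close>,
    so all slices would vanish.\<close>
  have "k \<noteq> 0"
  proof
    assume "k = 0"
    have "slice x s = 0" for s
    proof (cases "s \<in> rng m n")
      case True
      then show ?thesis using lowered_neg[OF deg[of s]] \<open>k = 0\<close> by (auto simp: rng_def)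
    qed (use x(3) in \<open>auto simp: vecs_dual_tensor_iff\<close>)
    then show False using x(2) slice_eqI[of x 0] by (simp add: slice_simps)
  qed
  then obtain k' where k': "k = Suc k'" by (cases k) auto
  have "act T p q x = 0" if pq: "p \<in> rng m n" "q \<in> rng m n" "p < q" for p q
  proof (rule ccontr)
    assume "act T p q x \<noteq> 0"
    have "degree_le (int k' - int (m + n) - 1 + int s) (slice (act T p q x) s)" for s
    proof -
      have "degree_le (int k' - int (m + n) - 1 + int s) (act W p q (slice x s))"
        using pq k' by (intro lowered_mono[OF degree_le_act[OF deg[of s] pq(1,2)]]) auto
      moreover have "degree_le (int k' - int (m + n) - 1 + int s) (slice x p)" if "s = q"
        using pq k' that by (intro lowered_mono[OF deg[of p]]) auto
      ultimately show ?thesis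
        unfolding slice_act_T[OF pq(1,2) x(3)]
        by (cases "s = q") (auto simp del: fvs.scale_minus_left intro!: lowered.add lowered.scale)
    qed
    then have "P k' (act T p q x)" using \<open>act T p q x \<noteq> 0\<close> inv[OF pq(1,2) x(1)] by (simp add: P_def)
    then have "k \<le> k'" unfolding k_def by (intro Least_le) blast
    then show False using k' by simp
  qed
  then show ?thesis using x by (auto simp: primitive_def)
qed

text \<open>For a primitive \<open>x\<close> whose first nonzero slice is as late as possible, the
  defect \<open>z\<close> of the weight equation is again primitive and vanishes at all slices up to
  \<open>r\<close>. By the choice of \<open>r\<close> it is zero.\<close>

lemma exists_maximal_in_submodule:
  assumes U: "submodule m n T U" and y: "y \<in> U" "y \<noteq> 0"
  obtains x r where "x \<in> U" "r \<in> rng m n" "maximal_vector m n T (\<lambda>k. \<Lambda> k - eps r k) x"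
proof -
  have UT: "U \<subseteq> vecs T" and sub: "fvs.subspace U"
    and inv: "\<And>p q x. p \<in> rng m n \<Longrightarrow> q \<in> rng m n \<Longrightarrow> x \<in> U \<Longrightarrow> act T p q x \<in> U"
    using U by (auto simp: submodule_iff)
  define P where "P r x \<longleftrightarrow> r \<in> rng m n \<and> x \<in> U \<and> primitive m n T x \<and> slice x r \<noteq> 0 \<and> (\<forall>s<r. slice x s = 0)"
    for r and x :: "nat \<times> 'i \<Rightarrow> complex"
  have P: "\<exists>r. P r x" if "x \<in> U" "x \<noteq> 0" "primitive m n T x" for x
  proof -
    have "x \<in> vecs T" using that UT by blast
    then show ?thesis using first_slice[of x] that unfolding P_def by metis
  qed
  have "\<exists>r x. P r x" using exists_primitive_in_submodule[OF assms] P by blast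
  moreover have fin: "finite {r. \<exists>x. P r x}"
    by (rule finite_subset[of _ "rng m n"]) (auto simp: P_def)
  ultimately have "Max {r. \<exists>x. P r x} \<in> {r. \<exists>x. P r x}" by (intro Max_in) auto
  then obtain r x where rx: "P r x" and rmax: "r = Max {r. \<exists>x. P r x}" by auto
  have x: "x \<in> vecs T" "x \<in> U" "primitive m n T x" "x \<noteq> 0" and r: "r \<in> rng m n" "\<And>s. s < r \<Longrightarrow> slice x s = 0"
    using rx UT by (auto simp: P_def slice_simps)
  obtain c where c: "slice x r = c \<cdot> w" using first_slice_primitive[OF x(3) r] by blast
  have "act T p p x = (\<Lambda> p - eps r p) \<cdot> x" if p: "p \<in> rng m n" for p
  proof (rule ccontr)
    define z where "z = act T p p x - (\<Lambda> p - eps r p) \<cdot> x"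
    assume "act T p p x \<noteq> (\<Lambda> p - eps r p) \<cdot> x"
    then have "z \<noteq> 0" by (simp add: z_def)
    moreover have "z \<in> U" unfolding z_def
      by (intro fvs.subspace_diff fvs.subspace_scale sub inv p x)
    moreover have "primitive m n T z" unfolding z_def
      by (intro T.primitive_diff T.primitive_scale T.primitive_act_diag x p)
    ultimately obtain r' where r': "P r' z" using P by blast
    have "slice z s = 0" if "s \<le> r" for s
      using that r(2)[of s] slice_weight[OF p x(1) c]
      by (cases "s = r") (auto simp: z_def slice_simps slice_act_diag[OF p x(1)] act_simps)
    then have "r < r'" using r' by (auto simp: P_def not_le[symmetric])
    moreover have "r' \<le> r" unfolding rmax using r' fin by (intro Max_ge) auto
    ultimately show False by simp
  qed
  then have "maximal_vector m n T (\<lambda>k. \<Lambda> k - eps r k) x"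
    using x by (simp add: maximal_vector_iff)
  then show ?thesis using that x r by blast
qed

section \<open>Pure tensors and generation by the highest weight vector\<close>

lemma pure_tensor_in_vecs: "s \<in> rng m n \<Longrightarrow> y \<in> vecs W \<Longrightarrow> pure_tensor s y \<in> vecs T"
  by (auto simp: vecs_dual_tensor_iff slice_pure_tensor fvs.subspace_0[OF subspace_vecs])

lemma act_pure_tensor:
  assumes "p \<in> rng m n" "q \<in> rng m n" "s \<in> rng m n" "y \<in> vecs W"
  shows "act T p q (pure_tensor s y) =
     (if s = p then - sgn1 (epar m p q \<and> pty m p) \<cdot> pure_tensor q y else 0)
     + sgn1 (epar m p q \<and> pty m s) \<cdot> pure_tensor s (act W p q y)"
  by (rule slice_eqI)
    (auto simp: slice_act_T[OF assms(1,2) pure_tensor_in_vecs[OF assms(3,4)]] slice_simps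
      slice_pure_tensor act_simps)

lemma even_part_pure_tensor:
  "even_part T (pure_tensor s y) = (if pty m s then pure_tensor s y - pure_tensor s (even_part W y)
     else pure_tensor s (even_part W y))"
  by (auto simp: even_part_def pure_tensor_def par_dual_tensor fun_eq_iff pointwise)

text \<open>The vectors \<open>y\<close> all of whose tensors \<open>pure_tensor s y\<close> lie in
  \<open>X\<close> form a submodule of \<open>W\<close>. It contains \<open>w\<close>, so it is
  \<open>W\<close>.\<close>

lemma generated_by_highest_tensors:
  assumes X: "submodule m n T X" and t: "\<And>s. s \<in> rng m n \<Longrightarrow> pure_tensor s w \<in> X"
  shows "X = vecs T"
proof -
  have XT: "X \<subseteq> vecs T" and sub: "fvs.subspace X"
    and inv: "\<And>p q x. p \<in> rng m n \<Longrightarrow> q \<in> rng m n \<Longrightarrow> x \<in> X \<Longrightarrow> act T p q x \<in> X"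
    and ev: "\<And>x. x \<in> X \<Longrightarrow> even_part T x \<in> X"
    using X by (auto simp: submodule_iff)
  define Y where "Y = {y \<in> vecs W. \<forall>s\<in>rng m n. pure_tensor s y \<in> X}"
  have "submodule m n W Y"
    unfolding submodule_iff
  proof (intro conjI ballI)
    show "Y \<subseteq> vecs W" by (auto simp: Y_def)
    show "fvs.subspace Y"
      by (rule fvs.subspaceI) (auto simp: Y_def pure_tensor_simps fvs.subspace_0[OF subspace_vecs]
          fvs.subspace_add[OF subspace_vecs] fvs.subspace_scale[OF subspace_vecs] fvs.subspace_0[OF sub]
          fvs.subspace_add[OF sub] fvs.subspace_scale[OF sub])
  next
    fix p q y assume pq: "p \<in> rng m n" "q \<in> rng m n" and y: "y \<in> Y"
    have "pure_tensor s (act W p q y) \<in> X" if s: "s \<in> rng m n" for s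
    proof -
      have yW: "y \<in> vecs W" and yX: "\<And>s. s \<in> rng m n \<Longrightarrow> pure_tensor s y \<in> X" using y by (auto simp: Y_def)
      \<comment> \<open>The action formula solved for its second term; the sign is its own
        inverse.\<close>
      have "pure_tensor s (act W p q y) = sgn1 (epar m p q \<and> pty m s) \<cdot> (act T p q (pure_tensor s y)
          - (if s = p then - sgn1 (epar m p q \<and> pty m p) \<cdot> pure_tensor q y else 0))"
        by (simp only: act_pure_tensor[OF pq s yW] add_diff_cancel_left' fvs.scale_scale sgn1_sq fvs.scale_one)
      also have "\<dots> \<in> X"
        by (split if_split) (intro conjI impI fvs.subspace_scale[OF sub] fvs.subspace_diff[OF sub]
            fvs.subspace_0[OF sub] inv pq yX s)
      finally show ?thesis .
    qed
    then show "act W p q y \<in> Y" by (simp add: Y_def act_in_vecs)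
  next
    fix y assume y: "y \<in> Y"
    have "pure_tensor s (even_part W y) \<in> X" if s: "s \<in> rng m n" for s
    proof -
      have yX: "pure_tensor s y \<in> X" using y s by (auto simp: Y_def)
      have "pure_tensor s (even_part W y) =
         (if pty m s then pure_tensor s y - even_part T (pure_tensor s y) else even_part T (pure_tensor s y))"
        by (simp add: even_part_pure_tensor)
      also have "\<dots> \<in> X" using ev[OF yX] yX fvs.subspace_diff[OF sub] by auto
      finally show ?thesis .
    qed
    then show "even_part W y \<in> Y" using y by (simp add: Y_def even_part_in_vecs)
  qed
  moreover have "w \<in> Y" using t w_in_vecs by (simp add: Y_def)
  ultimately have "Y = vecs W" using w_nonzero by (rule submodule_trivial)
  then have tensor: "pure_tensor s y \<in> X" if "s \<in> rng m n" "y \<in> vecs W" for s y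
    using that unfolding Y_def by blast
  have "x \<in> X" if x: "x \<in> vecs T" for x
  proof -
    have "x = (\<Sum>s\<in>rng m n. pure_tensor s (slice x s))"
    proof
      fix a :: "nat \<times> 'i"
      obtain t i where a: "a = (t, i)" by (cases a) auto
      have "x (t, i) = 0" if "t \<notin> rng m n"
        using x that by (auto simp: vecs_dual_tensor_iff slice_def fun_eq_iff pointwise)
      then show "x a = (\<Sum>s\<in>rng m n. pure_tensor s (slice x s)) a"
        by (simp add: a sum_fun_apply pure_tensor_def slice_def)
    qed
    also have "\<dots> \<in> X"
      using x by (intro fvs.subspace_sum sub tensor) (auto simp: vecs_dual_tensor_iff)
    finally show ?thesis .
  qed
  then show ?thesis using XT by blast
qed

end

section \<open>Complete reducibility\<close>

context gl_module
begin

lemma submodule_sum: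
  assumes U: "submodule m n M U" and U': "submodule m n M U'"
  shows "submodule m n M {x + y |x y. x \<in> U \<and> y \<in> U'}"
proof -
  let ?Y = "{x + y |x y. x \<in> U \<and> y \<in> U'}"
  have "fvs.subspace ?Y"
    using U U' by (intro fvs.subspace_sums) (auto simp: submodule_iff)
  moreover have "?Y \<subseteq> vecs M"
    using U U' fvs.subspace_add[OF subspace_vecs] unfolding submodule_iff by blast
  moreover have "act M p q (x + y) \<in> ?Y"
    if "x \<in> U" "y \<in> U'" "p \<in> rng m n" "q \<in> rng m n" for p q x y
    using that U U' unfolding submodule_iff act_simps by blast
  moreover have "even_part M (x + y) \<in> ?Y" if "x \<in> U" "y \<in> U'" for x y
    using that U U' unfolding submodule_iff even_part_simps by blast
  ultimately show ?thesis
    unfolding submodule_iff by blast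
qed

lemma submodule_zero: "submodule m n M {0}"
  by (auto simp: submodule_iff act_simps even_part_simps fvs.subspace_0[OF subspace_vecs])

lemma submodule_Int: "submodule m n M U \<Longrightarrow> submodule m n M U' \<Longrightarrow> submodule m n M (U \<inter> U')"
  by (auto simp: submodule_iff fvs.subspace_inter)

lemma casimir_maximal_vector:
  assumes "maximal_vector m n M \<mu> x"
  shows "casimir m n M x = chi2 m n \<mu> \<cdot> x"
  using casimir_highest_weight_mod[OF submodule_zero, of x \<mu>] assms
  by (auto simp: maximal_vector_iff primitive_def)

end

context highest_weight_irrep
begin

section \<open>The filtration by highest tensors and the Casimir eigenspaces\<close>

abbreviation \<chi> :: "nat \<Rightarrow> complex" where
  "\<chi> r \<equiv> chi2 m n (\<lambda>k. \<Lambda> k - eps r k)"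

abbreviation eigenspaces :: "nat set \<Rightarrow> (nat \<times> 'i \<Rightarrow> complex) set" where
  "eigenspaces J \<equiv> eigensums (vecs T) (casimir m n T) \<chi> J"

text \<open>A decreasing filtration by submodules, from the whole tensor product at
  \<open>k = 0\<close> to zero at \<open>k = m + n\<close>.\<close>

definition gen_above :: "nat \<Rightarrow> (nat \<times> 'i \<Rightarrow> complex) set" where
  "gen_above k = generated m n T ((\<lambda>s. pure_tensor s w) ` {s \<in> rng m n. k < s})"

lemma submodule_gen_above: "submodule m n T (gen_above k)"
  unfolding gen_above_def
  by (rule T.submodule_generated) (auto intro: pure_tensor_in_vecs w_in_vecs)

lemma pure_tensor_in_gen_above: "s \<in> rng m n \<Longrightarrow> k < s \<Longrightarrow> pure_tensor s w \<in> gen_above k"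
  unfolding gen_above_def by (rule generated_inc) auto

lemma gen_above_least:
  "submodule m n T X \<Longrightarrow> (\<And>s. s \<in> rng m n \<Longrightarrow> k < s \<Longrightarrow> pure_tensor s w \<in> X) \<Longrightarrow> gen_above k \<subseteq> X"
  unfolding gen_above_def by (rule generated_least) auto

text \<open>A raising operator kills \<open>w\<close> and can only replace \<open><s|\<close> by
  some \<open><q|\<close> with \<open>q > s\<close>.\<close>

lemma act_highest_tensor:
  assumes "p \<in> rng m n" "q \<in> rng m n" "p < q" "s \<in> rng m n"
  shows "act T p q (pure_tensor s w) \<in> gen_above s"
proof -
  have "act W p q w = 0" using w_primitive assms by (simp add: primitive_def)
  then show ?thesis
    using assms submodule_gen_above[of s] pure_tensor_in_gen_above[of q s]
    by (auto simp: act_pure_tensor[OF assms(1,2,4) w_in_vecs] pure_tensor_simps submodule_iff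
        fvs.subspace_0 fvs.subspace_scale fvs.subspace_neg)
qed

lemma weight_highest_tensor:
  assumes "p \<in> rng m n" "s \<in> rng m n"
  shows "act T p p (pure_tensor s w) = (\<Lambda> p - eps s p) \<cdot> pure_tensor s w"
  using assms
  by (auto simp: act_pure_tensor w_in_vecs w_weight pure_tensor_simps eps_def fvs.scale_left_diff_distrib)

text \<open>On \<open>gen_above k\<close> the operator \<open>casimir - \<chi> k\<close> is
  invertible, so its value on \<open>pure_tensor k w\<close> can be corrected away inside
  \<open>gen_above k\<close>. The result \<open>u\<close> is zero exactly when the tensor already
  lies in \<open>gen_above k\<close>.\<close>

lemma exists_eigenvector_mod_gen_above:
  assumes inj: "inj_on \<chi> (rng m n)" and k: "k \<in> rng m n"
    and sub: "gen_above k \<subseteq> eigenspaces {k<..m+n}"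
  shows "\<exists>u\<in>vecs T. casimir m n T u = \<chi> k \<cdot> u \<and> pure_tensor k w - u \<in> gen_above k \<and>
    (u = 0 \<or> maximal_vector m n T (\<lambda>j. \<Lambda> j - eps k j) u)"
proof -
  let ?t = "pure_tensor k w" and ?J = "{k<..m+n}" and ?C = "casimir m n T"
  have J: "insert k ?J \<subseteq> rng m n" using k by (auto simp: rng_def)
  have injJ: "inj_on \<chi> (insert k ?J)" using inj J by (rule inj_on_subset)
  have G: "fvs.subspace (gen_above k)"
    and inv: "\<And>p q x. p \<in> rng m n \<Longrightarrow> q \<in> rng m n \<Longrightarrow> x \<in> gen_above k \<Longrightarrow> act T p q x \<in> gen_above k"
    using submodule_gen_above[of k] by (auto simp: submodule_iff)
  \<comment> \<open>Only the eigenvalues \<open>\<chi> s\<close> with \<open>s > k\<close> occur on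
    \<open>gen_above k\<close>. This forces the defects of maximality of \<open>u\<close>, which are
    \<open>\<chi> k\<close> eigenvectors in \<open>gen_above k\<close>, to be zero.\<close>
  have vanish: "x = 0" if "x \<in> gen_above k" "?C x = \<chi> k \<cdot> x" for x
    using that sub by (intro eigenvector_notin_eigensums[OF lin_casimir _ injJ]) auto
  let ?v = "?C ?t - \<chi> k \<cdot> ?t"
  have v: "?v \<in> gen_above k"
    by (rule T.casimir_highest_weight_mod[OF submodule_gen_above])
      (use k in \<open>auto simp: act_highest_tensor weight_highest_tensor fvs.subspace_0[OF G]\<close>)
  then have "?v \<in> eigensums (gen_above k) ?C \<chi> ?J"
    using sub injJ
    by (intro eigensums_restrict[OF lin_casimir G T.submodule_casimir[OF submodule_gen_above]]) auto
  then obtain z where z: "?v = sum z ?J" "\<And>s. s \<in> ?J \<Longrightarrow> z s \<in> gen_above k"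
    "\<And>s. s \<in> ?J \<Longrightarrow> ?C (z s) = \<chi> s \<cdot> z s"
    unfolding eigensums_def by blast
  \<comment> \<open>The preimage of \<open>?v\<close> under \<open>casimir - \<chi> k\<close>: each
    component is divided by the difference of the eigenvalues.\<close>
  define e where "e = (\<Sum>s\<in>?J. (1 / (\<chi> s - \<chi> k)) \<cdot> z s)"
  have e: "e \<in> gen_above k"
    unfolding e_def by (intro fvs.subspace_sum fvs.subspace_scale G z(2))
  have ev: "?C e - \<chi> k \<cdot> e = ?v"
  proof -
    have "?C e - \<chi> k \<cdot> e = (\<Sum>s\<in>?J. (1 / (\<chi> s - \<chi> k)) \<cdot> (?C (z s) - \<chi> k \<cdot> z s))"
      by (simp add: e_def lin_sum[OF lin_casimir] lin_scale[OF lin_casimir] fvs.scale_sum_right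
          sum_subtractf fvs.scale_right_diff_distrib mult.commute)
    also have "\<dots> = sum z ?J"
    proof (rule sum.cong[OF refl])
      fix s assume s: "s \<in> ?J"
      have "\<chi> s \<noteq> \<chi> k" using inj_onD[OF injJ, of s k] s by auto
      moreover have "?C (z s) - \<chi> k \<cdot> z s = (\<chi> s - \<chi> k) \<cdot> z s"
        using z(3)[OF s] by (simp add: fvs.scale_left_diff_distrib)
      ultimately show "(1 / (\<chi> s - \<chi> k)) \<cdot> (?C (z s) - \<chi> k \<cdot> z s) = z s" by simp
    qed
    finally show ?thesis using z(1) by simp
  qed
  define u where "u = ?t - e"
  have uT: "u \<in> vecs T"
    using e submodule_gen_above[of k] pure_tensor_in_vecs[OF k w_in_vecs]
    by (auto simp: u_def submodule_iff intro!: fvs.subspace_diff[OF subspace_vecs])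
  have Cu: "?C u = \<chi> k \<cdot> u"
    using ev by (simp add: u_def lin_diff[OF lin_casimir] fvs.scale_right_diff_distrib algebra_simps)
  have raise: "act T p q u = 0" if pq: "p \<in> rng m n" "q \<in> rng m n" "p < q" for p q
  proof (rule vanish)
    show "act T p q u \<in> gen_above k"
      unfolding u_def act_simps
      by (intro fvs.subspace_diff G inv act_highest_tensor pq k e)
    show "?C (act T p q u) = \<chi> k \<cdot> act T p q u"
      using pq by (simp add: T.casimir_act Cu act_simps)
  qed
  have weight: "act T p p u = (\<Lambda> p - eps k p) \<cdot> u" if p: "p \<in> rng m n" for p
  proof -
    have "act T p p u - (\<Lambda> p - eps k p) \<cdot> u = 0"
    proof (rule vanish)
      have "act T p p u - (\<Lambda> p - eps k p) \<cdot> u = (\<Lambda> p - eps k p) \<cdot> e - act T p p e"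
        by (simp add: u_def act_simps weight_highest_tensor p k fvs.scale_right_diff_distrib)
      also have "\<dots> \<in> gen_above k" by (intro fvs.subspace_diff fvs.subspace_scale G inv p e)
      finally show "act T p p u - (\<Lambda> p - eps k p) \<cdot> u \<in> gen_above k" .
      show "?C (act T p p u - (\<Lambda> p - eps k p) \<cdot> u) = \<chi> k \<cdot> (act T p p u - (\<Lambda> p - eps k p) \<cdot> u)"
        using p by (simp add: lin_diff[OF lin_casimir] lin_scale[OF lin_casimir] T.casimir_act Cu
            act_simps fvs.scale_right_diff_distrib mult.commute)
    qed
    then show ?thesis by simp
  qed
  have "u = 0 \<or> maximal_vector m n T (\<lambda>j. \<Lambda> j - eps k j) u"
    using raise weight uT by (auto simp: maximal_vector_iff primitive_def)
  moreover have "?t - u \<in> gen_above k" using e by (simp add: u_def)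
  ultimately show ?thesis using uT Cu by blast
qed

text \<open>Passing from \<open>k + 1\<close> down to \<open>k\<close> adds one generator, the
  tensor at \<open>k + 1\<close>, which is an eigenvector for \<open>\<chi> (k + 1)\<close> plus an
  element of \<open>gen_above (k + 1)\<close>.\<close>

lemma gen_above_in_eigenspaces:
  assumes inj: "inj_on \<chi> (rng m n)" and "k \<le> m + n"
  shows "gen_above k \<subseteq> eigenspaces {k<..m+n}"
  using assms(2)
proof (induction rule: inc_induct)
  case base
  show ?case
    by (rule gen_above_least[OF T.submodule_casimir_eigensums]) (auto simp: rng_def)
next
  case (step k)
  have k: "Suc k \<in> rng m n" using step.hyps by (auto simp: rng_def)
  let ?E = "eigenspaces {k<..m+n}"
  have sub: "fvs.subspace ?E" by (intro subspace_eigensums lin_casimir subspace_vecs)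
  have mono: "gen_above (Suc k) \<subseteq> ?E"
    using step.IH eigensums_mono[OF lin_casimir subspace_vecs, of "{Suc k<..m+n}" "{k<..m+n}"] by fastforce
  obtain u where u: "u \<in> vecs T" "casimir m n T u = \<chi> (Suc k) \<cdot> u"
    "pure_tensor (Suc k) w - u \<in> gen_above (Suc k)"
    using exists_eigenvector_mod_gen_above[OF inj k step.IH] by blast
  have "u \<in> ?E"
    using u(1,2) step.hyps
    by (intro eigenvector_in_eigensums[where \<chi> = \<chi> and a = "Suc k"] lin_casimir subspace_vecs) auto
  then have "u + (pure_tensor (Suc k) w - u) \<in> ?E"
    using u(3) mono by (intro fvs.subspace_add sub) auto
  then have t: "pure_tensor (Suc k) w \<in> ?E" by simp
  show ?case
  proof (rule gen_above_least[OF T.submodule_casimir_eigensums])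
    fix s assume s: "s \<in> rng m n" "k < s"
    show "pure_tensor s w \<in> ?E"
    proof (cases "s = Suc k")
      case False
      then show ?thesis using s mono pure_tensor_in_gen_above[of s "Suc k"] by auto
    qed (use t in simp)
  qed
qed

text \<open>A nonzero intersection would contain a maximal vector, with some index \<open>r\<close>
  in \<open>S\<close>; but \<open>U'\<close> has no eigenvectors for \<open>\<chi> r\<close>. That
  the sum is everything follows by collecting the highest tensors one at a time, from the last index
  down.\<close>

lemma exists_complement:
  assumes inj: "inj_on \<chi> (rng m n)" and U: "submodule m n T U"
  shows "\<exists>U'. submodule m n T U' \<and> U \<inter> U' = {0} \<and> (\<forall>x\<in>vecs T. \<exists>u\<in>U. \<exists>u'\<in>U'. x = u + u')"
proof -
  define S where "S = {r \<in> rng m n. \<exists>v\<in>U. maximal_vector m n T (\<lambda>k. \<Lambda> k - eps r k) v}"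
  define U' where "U' = eigenspaces (rng m n - S)"
  have U': "submodule m n T U'" unfolding U'_def by (rule T.submodule_casimir_eigensums)
  have "x = 0" if x: "x \<in> U \<inter> U'" for x
  proof (rule ccontr)
    assume "x \<noteq> 0"
    then obtain v r where v: "v \<in> U \<inter> U'" "r \<in> rng m n" "maximal_vector m n T (\<lambda>k. \<Lambda> k - eps r k) v"
      using exists_maximal_in_submodule[OF T.submodule_Int[OF U U'] x] by blast
    then have "r \<in> S" by (auto simp: S_def)
    have "v = 0"
    proof (rule eigenvector_notin_eigensums[OF lin_casimir])
      show "inj_on \<chi> (insert r (rng m n - S))" using v(2) by (intro inj_on_subset[OF inj]) auto
      show "casimir m n T v = \<chi> r \<cdot> v" using v(3) by (rule T.casimir_maximal_vector)
      show "v \<in> eigenspaces (rng m n - S)" using v(1) by (simp add: U'_def)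
    qed (use \<open>r \<in> S\<close> in auto)
    then show False using v(3) by (simp add: maximal_vector_iff)
  qed
  then have "U \<inter> U' = {0}"
    using U U' by (auto simp: submodule_iff fvs.subspace_0)
  define Y where "Y = {u + u' |u u'. u \<in> U \<and> u' \<in> U'}"
  have Y: "submodule m n T Y" unfolding Y_def using U U' by (rule T.submodule_sum)
  then have subY: "fvs.subspace Y" by (simp add: submodule_iff)
  have UY: "U \<subseteq> Y" "U' \<subseteq> Y"
  proof -
    have "0 \<in> U" "0 \<in> U'" using U U' by (auto simp: submodule_iff fvs.subspace_0)
    then show "U \<subseteq> Y" "U' \<subseteq> Y" unfolding Y_def by force+
  qed
  have "gen_above k \<subseteq> Y" if "k \<le> m + n" for k
    using that
  proof (induction rule: inc_induct)
    case base
    show ?case by (rule gen_above_least[OF Y]) (auto simp: rng_def)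
  next
    case (step k)
    have k: "Suc k \<in> rng m n" "Suc k \<le> m + n" using step.hyps by (auto simp: rng_def)
    obtain u where u: "u \<in> vecs T" "casimir m n T u = \<chi> (Suc k) \<cdot> u"
      "pure_tensor (Suc k) w - u \<in> gen_above (Suc k)"
      "u = 0 \<or> maximal_vector m n T (\<lambda>j. \<Lambda> j - eps (Suc k) j) u"
      using exists_eigenvector_mod_gen_above[OF inj k(1) gen_above_in_eigenspaces[OF inj k(2)]] by blast
    \<comment> \<open>If \<open>U\<close> has a maximal vector of this weight, uniqueness makes
      \<open>u\<close> a multiple of it; otherwise the eigenvalue of \<open>u\<close> is among those
      collected in \<open>U'\<close>.\<close>
    have "u \<in> Y"
    proof (cases "Suc k \<in> S")
      case True
      then obtain v where v: "v \<in> U" "maximal_vector m n T (\<lambda>j. \<Lambda> j - eps (Suc k) j) v"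
        by (auto simp: S_def)
      have "u \<in> U"
      proof (cases "u = 0")
        case False
        then obtain c where "u = c \<cdot> v" using maximal_unique[OF v(2)] u(4) by blast
        then show ?thesis using v(1) U by (simp add: submodule_iff fvs.subspace_scale)
      qed (use U in \<open>simp add: submodule_iff fvs.subspace_0\<close>)
      then show ?thesis using UY by blast
    next
      case False
      then have "u \<in> U'" unfolding U'_def
        using u(1,2) k
        by (intro eigenvector_in_eigensums[where \<chi> = \<chi> and a = "Suc k"] lin_casimir subspace_vecs) auto
      then show ?thesis using UY by blast
    qed
    then have "u + (pure_tensor (Suc k) w - u) \<in> Y"
      using u(3) step.IH by (intro fvs.subspace_add subY) auto
    then have t: "pure_tensor (Suc k) w \<in> Y" by simp
    show ?case
    proof (rule gen_above_least[OF Y])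
      fix s assume s: "s \<in> rng m n" "k < s"
      show "pure_tensor s w \<in> Y"
      proof (cases "s = Suc k")
        case False
        then show ?thesis using s step.IH pure_tensor_in_gen_above[of s "Suc k"] by auto
      qed (use t in simp)
    qed
  qed
  then have "gen_above 0 \<subseteq> Y" by simp
  then have "Y = vecs T"
    using pure_tensor_in_gen_above[of _ 0] by (intro generated_by_highest_tensors Y) (auto simp: rng_def)
  then have "\<forall>x\<in>vecs T. \<exists>u\<in>U. \<exists>u'\<in>U'. x = u + u'" unfolding Y_def by blast
  then show ?thesis using U' \<open>U \<inter> U' = {0}\<close> by blast
qed

end

text \<open>The even part of a maximal vector satisfies the same equations. If it is nonzero it
  serves as \<open>w\<close>; otherwise the vector itself is odd.\<close>

lemma irrep_hw_homogeneous:
  assumes "irrep_hw m n W \<Lambda>"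
  shows "\<exists>w. highest_weight_irrep m n W \<Lambda> w"
proof -
  interpret gl_module m n W using assms by unfold_locales (simp add: irrep_hw_def)
  obtain x where x: "maximal_vector m n W \<Lambda> x" using assms by (auto simp: irrep_hw_def)
  have max: "maximal_vector m n W \<Lambda> y"
    if "y \<noteq> 0" "y = even_part W x \<or> y = x - even_part W x" for y
    using that x unfolding maximal_vector_iff
    by (auto simp: primitive_even_part primitive_diff act_even_part act_simps even_part_simps
        fvs.scale_right_diff_distrib)
  have idem: "even_part W (even_part W x) = even_part W x"
    by (auto simp: even_part_def)
  have "\<exists>w. maximal_vector m n W \<Lambda> w \<and> (even_part W w = w \<or> even_part W w = 0)"
  proof (cases "even_part W x = 0")
    case True
    then show ?thesis using x by blast
  next
    case False
    then show ?thesis using max[of "even_part W x"] idem by blast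
  qed
  then show ?thesis
    using assms unfolding highest_weight_irrep_def highest_weight_irrep_axioms_def gl_module_def irrep_hw_def
    by blast
qed

theorem theorem10:
  fixes m n :: nat and W :: "'i smod" and \<Lambda> :: "nat \<Rightarrow> complex"
  assumes "irrep_hw m n W \<Lambda>"
    and "\<forall>r\<in>rng m n. \<forall>r'\<in>rng m n. r \<noteq> r' \<longrightarrow>
           chi2 m n (\<lambda>k. \<Lambda> k - eps r k) \<noteq> chi2 m n (\<lambda>k. \<Lambda> k - eps r' k)"
  shows "completely_reducible m n (tensormod m (dualmod m (vecmod m n)) W)
       \<and> (\<forall>\<mu> x. maximal_vector m n (tensormod m (dualmod m (vecmod m n)) W) \<mu> x \<longrightarrow>
              (\<exists>r\<in>rng m n. \<forall>k\<in>rng m n. \<mu> k = \<Lambda> k - eps r k))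
       \<and> (\<forall>\<mu> x y. maximal_vector m n (tensormod m (dualmod m (vecmod m n)) W) \<mu> x
              \<and> maximal_vector m n (tensormod m (dualmod m (vecmod m n)) W) \<mu> y
              \<longrightarrow> (\<exists>c. y = (\<lambda>i. c * x i)))"
proof -
  obtain w where "highest_weight_irrep m n W \<Lambda> w"
    using irrep_hw_homogeneous[OF assms(1)] by blast
  then interpret highest_weight_irrep m n W \<Lambda> w .
  have "inj_on (\<lambda>r. chi2 m n (\<lambda>k. \<Lambda> k - eps r k)) (rng m n)"
    using assms(2) by (auto simp: inj_on_def)
  then have "completely_reducible m n T"
    using exists_complement unfolding completely_reducible_def zero_fun_def plus_fun_def by blast
  moreover have "\<exists>r\<in>rng m n. \<forall>k\<in>rng m n. \<mu> k = \<Lambda> k - eps r k"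
    if "maximal_vector m n T \<mu> x" for \<mu> x
    using maximal_first_slice[OF that] by blast
  moreover have "\<exists>c. y = (\<lambda>i. c * x i)"
    if "maximal_vector m n T \<mu> x" "maximal_vector m n T \<mu> y" for \<mu> x y
    using maximal_unique[OF that] unfolding scl_def .
  ultimately show ?thesis by blast
qed

end
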